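(* Let $d\ge 18$ be an integer and let $0<\theta<\theta_0$, where $\theta_0=\frac{p/18-1}{2p+4}$ and $p=\lfloor 17d/16\rfloor$. Then for every $\kappa\in(0,1)$ there exists $c_\kappa>0$ (independent of $N$) such that, on the domain $$\mathcal D:=\{z=E+i\eta\in\mathbb C:\ E\in(\kappa,4-\kappa)\text{ and }\eta\in(N^{-\theta},c_\kappa)\},$$ with high probability it holds that $$|m_N(z)-m_{\mathrm{MP}}(z)|\le \frac{N^{-\theta_0}}{\operatorname{Im}[z]}\qquad\text{for all } z\in\mathcal D .$$ That is, the probability that this inequality fails for some $z\in\mathcal D$ tends to $0$ as $N\to\infty$, for fixed $d,\theta,\kappa$.
   Context: Random matrix ensemble: let $\rho:\mathbb R/\mathbb Z\to[0,\infty)$ be a probability density on the $1$-torus with bounded derivative, $\|\rho'\|_\infty\le C$ ($\rho$ does not depend on $N$). For every $N\ge1$, let $\{\omega_{j,q}\}_{1\le j\le N,\,1\le q\le d}$ be independent random variables on $\mathbb R/\mathbb Z$, each with distribution $\rho(\omega)\,d\omega$. The $N\times N$ random matrix $X_N$ is defined by $[X_N]_{jk}=\frac1{\sqrt N}\exp\left(2\pi i\sum_{q=1}^d\omega_{j,q}k^q\right)$. Stieltjes transforms: for $z\in\mathbb C$ with $\operatorname{Im}[z]>0$, $m_N(z)=\frac1N\operatorname{tr}\left((X_NX_N^*-z)^{-1}\right)=\frac1N\sum_{j=1}^N\frac1{\sigma_j^2-z}$, where $\sigma_1,\dots,\sigma_N$ are the singular values of $X_N$; and $m_{\mathrm{MP}}(z)=\int_{\mathbb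 R}\frac{1}{x-z}\rho_{\mathrm{MP}}(x)\,dx$ with $\rho_{\mathrm{MP}}(x)=\frac1{2\pi x}\sqrt{x(4-x)}\,\mathbf 1_{0\le x\le4}$ (Marchenko-Pastur density). An estimate $A\le B$ holds with high probability if $\mathbb P(A>B)\to0$ as $N\to\infty$ for every fixed value of $d$. *)

theory Defs
  imports
    "HOL-Probability.Probability"
    "Jordan_Normal_Form.Schur_Decomposition"
    "Jordan_Normal_Form.Gauss_Jordan_Elimination"
begin

text \<open>Functions on the torus are 1-periodic functions on the reals.\<close>

definition torus_density :: "real \<Rightarrow> (real \<Rightarrow> real) \<Rightarrow> bool" where
  "torus_density C \<rho> \<longleftrightarrow>
     (\<forall>x. \<rho> (x + 1) = \<rho> x) \<and> (\<forall>x. 0 \<le> \<rho> x) \<and> (\<rho> has_integral 1) {0..1} \<and>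
     (\<forall>x. \<rho> differentiable (at x)) \<and> (\<forall>x. \<bar>deriv \<rho> x\<bar> \<le> C)"

text \<open>A torus-valued random variable is represented by its lift to the fundamental domain
  \<open>[0,1)\<close>; the matrix below only depends on the class modulo 1.\<close>

definition iid_torus_array ::
    "'a measure \<Rightarrow> (real \<Rightarrow> real) \<Rightarrow> nat \<Rightarrow> nat \<Rightarrow> (nat \<Rightarrow> nat \<Rightarrow> 'a \<Rightarrow> real) \<Rightarrow> bool" where
  "iid_torus_array M \<rho> N d \<omega> \<longleftrightarrow>
     prob_space.indep_vars M (\<lambda>_. borel) (\<lambda>(j, q). \<omega> j q) ({1..N} \<times> {1..d}) \<and>
     (\<forall>j\<in>{1..N}. \<forall>q\<in>{1..d}.
        distributed M lborel (\<omega> j q) (\<lambda>x. ennreal (\<rho> x * indicator {0..<1} x)))"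

text \<open>Matrix indices start at 0 in the library, whence the shifts by one.\<close>

definition X_mat :: "nat \<Rightarrow> nat \<Rightarrow> (nat \<Rightarrow> nat \<Rightarrow> real) \<Rightarrow> complex mat" where
  "X_mat N d w = Matrix.mat N N (\<lambda>(j, k).
     1 / complex_of_real (sqrt (real N)) *
     exp (2 * complex_of_real pi * \<i> *
       complex_of_real (\<Sum>q = 1..d. w (j + 1) q * real (k + 1) ^ q)))"

definition mat_trace :: "'a::comm_monoid_add mat \<Rightarrow> 'a" where
  "mat_trace A = (\<Sum>i<dim_row A. A $$ (i, i))"

text \<open>For \<open>Im z > 0\<close> the matrix to be inverted is invertible, so \<open>the\<close> is harmless.\<close>

definition m_emp :: "nat \<Rightarrow> nat \<Rightarrow> (nat \<Rightarrow> nat \<Rightarrow> real) \<Rightarrow> complex \<Rightarrow> complex" where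
  "m_emp N d w z =
     (let X = X_mat N d w
      in 1 / of_nat N * mat_trace (the (mat_inverse (X * mat_adjoint X - z \<cdot>\<^sub>m 1\<^sub>m N))))"

definition rho_MP :: "real \<Rightarrow> real" where
  "rho_MP x = 1 / (2 * pi * x) * sqrt (x * (4 - x)) * indicator {0..4} x"

definition m_MP :: "complex \<Rightarrow> complex" where
  "m_MP z = (LINT x|lborel. 1 / (complex_of_real x - z) * complex_of_real (rho_MP x))"

definition theta0 :: "nat \<Rightarrow> real" where
  "theta0 d = (let p = real_of_int \<lfloor>17 * real d / 16\<rfloor> in (p / 18 - 1) / (2 * p + 4))"

text \<open>This set is open and both transforms are continuous in \<open>z\<close>, so failure of a non-strict
  bound somewhere in it can be tested on a countable dense subset and is a measurable event.\<close>

definition spectral_domain :: "real \<Rightarrow> real \<Rightarrow> real \<Rightarrow> nat \<Rightarrow> complex set" where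
  "spectral_domain \<kappa> \<theta> c N =
     {z. Re z \<in> {\<kappa><..<4 - \<kappa>} \<and> Im z \<in> {real N powr (-\<theta>)<..<c}}"

end

theory Submission
  imports Defs
begin

text \<open>
  Write \<open>x\<^sub>j\<close> for the rows of \<open>X\<close>, \<open>R = (X\<^sup>* X - z)\<^sup>-\<^sup>1\<close>, and \<open>R\<^sub>j\<close> for the same resolvent with
  the row \<open>x\<^sub>j\<close> replaced by \<open>0\<close>. The Sherman--Morrison formula gives, with \<open>q\<^sub>j = x\<^sub>j R\<^sub>j x\<^sub>j\<^sup>*\<close> and \<open>m = tr R / N\<close>,
  \<open>z m\<^sup>2 + z m + 1 = N\<^sup>-\<^sup>1 \<Sum>\<^sub>j (q\<^sub>j - m) / (1 + q\<^sub>j)\<close>. The transform \<open>m\<^sub>M\<^sub>P\<close> is a root of the left-hand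
  side, and in the bulk the other root stays away from the upper half plane, so that
  \<open>|m - m\<^sub>M\<^sub>P|\<close> is controlled by the average of the \<open>|q\<^sub>j - tr R\<^sub>j / N|\<close>.

  Conditionally on everything except \<open>\<omega>\<^sub>j\<^sub>1, \<omega>\<^sub>j\<^sub>2\<close>, the difference \<open>q\<^sub>j - tr R\<^sub>j / N\<close> is a trigonometric
  polynomial in these two variables with frequencies \<open>(k - l, k\<^sup>2 - l\<^sup>2)\<close>, \<open>k \<noteq> l\<close>. They are pairwise
  distinct, and a bounded density costs only a constant factor against the uniform one, so by
  orthogonality the second moment is at most a constant times
  \<open>N\<^sup>-\<^sup>2 |R\<^sub>j|\<^sup>2 \<le> 1 / (N \<eta>\<^sup>2)\<close> (Frobenius norm). A union bound over a grid and the Lipschitz continuity of the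
  two transforms finish the proof; there is ample room, since \<open>\<theta>\<^sub>0 < 1/36\<close> for all \<open>d\<close>.
\<close>

unbundle no vec_syntax

subsection \<open>Gram matrices and their resolvents\<close>

lemma mat_adjoint_dim [simp]: "dim_row (mat_adjoint A) = dim_col A" "dim_col (mat_adjoint A) = dim_row A"
  by (auto simp: mat_adjoint_def)

lemma mat_adjoint_carrier [simp]: "A \<in> carrier_mat n m \<Longrightarrow> mat_adjoint A \<in> carrier_mat m n"
  by auto

lemma mat_adjoint_index [simp]:
  fixes A :: "complex mat"
  shows "i < dim_col A \<Longrightarrow> j < dim_row A \<Longrightarrow> mat_adjoint A $$ (i, j) = cnj (A $$ (j, i))"
  by (simp add: mat_adjoint_def mat_of_rows_def conjugate_complex_def)

lemma mat_adjoint_adjoint [simp]: "mat_adjoint (mat_adjoint A) = (A :: complex mat)"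
  by (rule eq_matI) auto

text \<open>Phrased through \<open>L2_set\<close>, so that the Cauchy-Schwarz inequality for finite
  sums applies directly.\<close>

definition cnorm :: "complex Matrix.vec \<Rightarrow> real" where
  "cnorm v = L2_set (\<lambda>i. cmod (v $ i)) {..<dim_vec v}"

lemma cnorm_nonneg [simp]: "0 \<le> cnorm v"
  by (simp add: cnorm_def)

lemma cnorm_sq: "(cnorm v)\<^sup>2 = (\<Sum>i<dim_vec v. (cmod (v $ i))\<^sup>2)"
  by (simp add: cnorm_def L2_set_def sum_nonneg)

lemma inner_sum: "v \<bullet>c w = (\<Sum>i<dim_vec w. v $ i * cnj (w $ i))"
  by (simp add: scalar_prod_def lessThan_atLeast0 conjugate_complex_def)

lemma inner_self: "v \<bullet>c v = complex_of_real ((cnorm v)\<^sup>2)"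
  unfolding inner_sum cnorm_sq of_real_sum by (intro sum.cong refl complex_norm_square[symmetric])

lemma inner_Cauchy_Schwarz:
  assumes "dim_vec v = dim_vec w"
  shows "cmod (v \<bullet>c w) \<le> cnorm v * cnorm w"
proof -
  have "cmod (v \<bullet>c w) \<le> (\<Sum>i<dim_vec w. \<bar>cmod (v $ i)\<bar> * \<bar>cmod (w $ i)\<bar>)"
    unfolding inner_sum by (rule order_trans[OF norm_sum]) (simp add: norm_mult)
  also have "\<dots> \<le> cnorm v * cnorm w"
    unfolding cnorm_def assms by (rule L2_set_mult_ineq)
  finally show ?thesis .
qed

lemma inner_cnj: "dim_vec v = dim_vec w \<Longrightarrow> cnj (v \<bullet>c w) = w \<bullet>c v"
  by (simp add: inner_sum mult.commute)

lemma adjoint_inner: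
  fixes A :: "complex mat"
  assumes A: "A \<in> carrier_mat n m" and v: "v \<in> carrier_vec m" and w: "w \<in> carrier_vec n"
  shows "(A *\<^sub>v v) \<bullet>c w = v \<bullet>c (mat_adjoint A *\<^sub>v w)"
proof -
  have "(A *\<^sub>v v) \<bullet>c w = (\<Sum>i<n. \<Sum>k<m. A $$ (i, k) * v $ k * cnj (w $ i))"
    using A v w unfolding inner_sum
    by (auto simp: scalar_prod_def lessThan_atLeast0 sum_distrib_right)
  also have "\<dots> = (\<Sum>k<m. \<Sum>i<n. A $$ (i, k) * v $ k * cnj (w $ i))"
    by (rule sum.swap)
  also have "\<dots> = v \<bullet>c (mat_adjoint A *\<^sub>v w)"
    using A v w unfolding inner_sum
    by (auto simp: scalar_prod_def lessThan_atLeast0 sum_distrib_left intro!: sum.cong)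
  finally show ?thesis .
qed

section \<open>Quadratic forms of the Gram matrix and of its resolvent\<close>

text \<open>The factors stand in the opposite order to \<open>m_emp\<close>. In this order the
  matrix is the sum of the rank-one matrices \<open>x\<^sub>j\<^sup>* x\<^sub>j\<close> over the
  rows, so changing one row is a low-rank perturbation.\<close>

definition gram :: "complex mat \<Rightarrow> complex mat" where
  "gram X = mat_adjoint X * X"

lemma gram_dim [simp]: "dim_row (gram X) = dim_col X" "dim_col (gram X) = dim_col X"
  by (simp_all add: gram_def)

lemma gram_carrier [simp]: "X \<in> carrier_mat n n \<Longrightarrow> gram X \<in> carrier_mat n n"
  by (simp add: gram_def mult_carrier_mat[of _ n n])

lemma gram_index:
  assumes "X \<in> carrier_mat n n" "k < n" "l < n"
  shows "gram X $$ (k, l) = (\<Sum>j<n. cnj (X $$ (j, k)) * X $$ (j, l))"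
  using assms by (auto simp: gram_def scalar_prod_def lessThan_atLeast0)

text \<open>Moving the adjoint to the other side leaves a real number minus \<open>z\<close> times a
  real number. Invertibility and all resolvent bounds come from the imaginary part of this
  identity.\<close>

lemma gram_shift_inner:
  assumes X: "X \<in> carrier_mat n n" and v: "v \<in> carrier_vec n"
  shows "((gram X - z \<cdot>\<^sub>m 1\<^sub>m n) *\<^sub>v v) \<bullet>c v =
    complex_of_real ((cnorm (X *\<^sub>v v))\<^sup>2) - z * complex_of_real ((cnorm v)\<^sup>2)"
proof -
  have Xv: "X *\<^sub>v v \<in> carrier_vec n" using X v by auto
  have "(gram X - z \<cdot>\<^sub>m 1\<^sub>m n) *\<^sub>v v = gram X *\<^sub>v v - z \<cdot>\<^sub>v v"
    using X v by (subst minus_mult_distrib_mat_vec[of _ n n]) auto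
  then have "((gram X - z \<cdot>\<^sub>m 1\<^sub>m n) *\<^sub>v v) \<bullet>c v = (gram X *\<^sub>v v) \<bullet>c v - z * (v \<bullet>c v)"
    using X v mult_mat_vec_carrier[OF gram_carrier[OF X] v]
    by (simp add: minus_scalar_prod_distrib[of _ n])
  also have "(gram X *\<^sub>v v) \<bullet>c v = (X *\<^sub>v v) \<bullet>c (X *\<^sub>v v)"
    using X v Xv adjoint_inner[OF mat_adjoint_carrier[OF X] Xv v]
    by (simp add: gram_def assoc_mult_mat_vec[of _ n n])
  finally show ?thesis by (simp add: inner_self)
qed

text \<open>Cramer's rule is used as the definition because it makes the entries visibly measurable.\<close>

definition resolvent :: "complex mat \<Rightarrow> complex \<Rightarrow> complex mat" where
  "resolvent A z = (let B = A - z \<cdot>\<^sub>m 1\<^sub>m (dim_row A)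
     in inverse (Determinant.det B) \<cdot>\<^sub>m adj_mat B)"

text \<open>At a kernel vector \<open>v\<close> the quadratic form vanishes, but its imaginary part
  is \<open>- Im z * (cnorm v)\<^sup>2\<close>.\<close>

lemma gram_shift_det:
  assumes X: "X \<in> carrier_mat n n" and z: "Im z > 0"
  shows "Determinant.det (gram X - z \<cdot>\<^sub>m 1\<^sub>m n) \<noteq> 0"
proof
  let ?B = "gram X - z \<cdot>\<^sub>m 1\<^sub>m n"
  assume "Determinant.det ?B = 0"
  moreover have "?B \<in> carrier_mat n n" using X by auto
  ultimately obtain v where v: "v \<in> carrier_vec n" "v \<noteq> 0\<^sub>v n" "?B *\<^sub>v v = 0\<^sub>v n"
    using det_0_iff_vec_prod_zero_field by blast
  have "complex_of_real ((cnorm (X *\<^sub>v v))\<^sup>2) - z * complex_of_real ((cnorm v)\<^sup>2) = 0"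
    using gram_shift_inner[OF X v(1), of z] v by simp
  then have "Im z * (cnorm v)\<^sup>2 = 0"
    by (auto simp: complex_eq_iff)
  then have "v \<bullet>c v = 0" using z by (simp add: inner_self)
  then show False using v conjugate_square_eq_0_vec by blast
qed

lemma resolvent_carrier [simp]: "A \<in> carrier_mat n n \<Longrightarrow> resolvent A z \<in> carrier_mat n n"
  by (auto simp: resolvent_def Let_def adj_mat_def)

lemma
  assumes X: "X \<in> carrier_mat n n" and z: "Im z > 0"
  shows resolvent_right: "(gram X - z \<cdot>\<^sub>m 1\<^sub>m n) * resolvent (gram X) z = 1\<^sub>m n"
    and resolvent_left: "resolvent (gram X) z * (gram X - z \<cdot>\<^sub>m 1\<^sub>m n) = 1\<^sub>m n"
proof -
  let ?B = "gram X - z \<cdot>\<^sub>m 1\<^sub>m n"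
  have B: "?B \<in> carrier_mat n n" using X by auto
  note adj = adj_mat[OF B]
  have dr: "dim_col X = n" using X by blast
  have eq: "resolvent (gram X) z = inverse (Determinant.det ?B) \<cdot>\<^sub>m adj_mat ?B"
    by (simp add: resolvent_def Let_def dr)
  have one: "inverse (Determinant.det ?B) \<cdot>\<^sub>m (Determinant.det ?B \<cdot>\<^sub>m 1\<^sub>m n) = 1\<^sub>m n"
    using gram_shift_det[OF X z] by (intro eq_matI) auto
  show "?B * resolvent (gram X) z = 1\<^sub>m n"
    unfolding eq mult_smult_distrib[OF B adj(1)] adj(2) by (rule one)
  show "resolvent (gram X) z * ?B = 1\<^sub>m n"
    unfolding eq mult_smult_assoc_mat[OF adj(1) B] adj(3) by (rule one)
qed

text \<open>Since \<open>u\<close> is the image of \<open>v\<close> under the shifted Gram matrix,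
  this is the complex conjugate of the quadratic form at \<open>v\<close>.\<close>

lemma resolvent_inner:
  assumes X: "X \<in> carrier_mat n n" and z: "Im z > 0" and u: "u \<in> carrier_vec n"
  defines "v \<equiv> resolvent (gram X) z *\<^sub>v u"
  shows "v \<bullet>c u = complex_of_real ((cnorm (X *\<^sub>v v))\<^sup>2) - cnj z * complex_of_real ((cnorm v)\<^sup>2)"
proof -
  have R: "resolvent (gram X) z \<in> carrier_mat n n" using X by simp
  have v: "v \<in> carrier_vec n" using R u by (simp add: v_def)
  have "(gram X - z \<cdot>\<^sub>m 1\<^sub>m n) *\<^sub>v v = u"
    unfolding v_def using X u R
    by (subst assoc_mult_mat_vec[of _ n n _ n, symmetric]) (auto simp: resolvent_right[OF X z])
  then have "u \<bullet>c v = complex_of_real ((cnorm (X *\<^sub>v v))\<^sup>2) - z * complex_of_real ((cnorm v)\<^sup>2)"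
    using gram_shift_inner[OF X v, of z] by simp
  then have "cnj (u \<bullet>c v) = complex_of_real ((cnorm (X *\<^sub>v v))\<^sup>2) - cnj z * complex_of_real ((cnorm v)\<^sup>2)"
    by simp
  then show ?thesis using u v by (subst (asm) inner_cnj) auto
qed

text \<open>The form has imaginary part \<open>Im z * (cnorm v)\<^sup>2\<close>; after
  multiplication by \<open>z\<close> the imaginary part is
  \<open>Im z * (cnorm (X *\<^sub>v v))\<^sup>2\<close>. Comparing the first value with
  Cauchy-Schwarz and cancelling one factor \<open>cnorm v\<close> gives the norm bound.\<close>

lemma
  assumes X: "X \<in> carrier_mat n n" and z: "Im z > 0" and u: "u \<in> carrier_vec n"
  defines "v \<equiv> resolvent (gram X) z *\<^sub>v u"
  shows resolvent_inner_Im: "Im (v \<bullet>c u) \<ge> 0"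
    and resolvent_inner_Im_mult: "Im (z * (v \<bullet>c u)) \<ge> 0"
    and resolvent_norm_le: "cnorm v \<le> cnorm u / Im z"
proof -
  have eq: "v \<bullet>c u = complex_of_real ((cnorm (X *\<^sub>v v))\<^sup>2) - cnj z * complex_of_real ((cnorm v)\<^sup>2)"
    unfolding v_def by (rule resolvent_inner[OF X z u])
  have im: "Im (v \<bullet>c u) = Im z * (cnorm v)\<^sup>2"
    by (simp add: eq)
  then show "Im (v \<bullet>c u) \<ge> 0" using z by simp
  show "Im (z * (v \<bullet>c u)) \<ge> 0"
    using z by (simp add: eq algebra_simps)
  have R: "resolvent (gram X) z \<in> carrier_mat n n" using X by simp
  have v: "v \<in> carrier_vec n" using R u by (simp add: v_def)
  have "Im z * (cnorm v)\<^sup>2 \<le> cnorm v * cnorm u"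
    using abs_Im_le_cmod[of "v \<bullet>c u"] inner_Cauchy_Schwarz[of v u] u v im by auto
  then have "cnorm v * (Im z * cnorm v) \<le> cnorm v * cnorm u"
    by (simp add: power2_eq_square mult_ac)
  then have "cnorm v = 0 \<or> Im z * cnorm v \<le> cnorm u"
    by (auto simp: mult_le_cancel_left less_le)
  then show "cnorm v \<le> cnorm u / Im z"
    using z by (auto simp: field_simps)
qed


section \<open>Removing a row as a rank-one perturbation\<close>

definition crow :: "complex mat \<Rightarrow> nat \<Rightarrow> complex Matrix.vec" where
  "crow X j = Matrix.vec (dim_col X) (\<lambda>k. cnj (X $$ (j, k)))"

text \<open>The row is set to zero instead of being deleted, so that both matrices keep their size
  and the resolvents can be compared.\<close>

definition zero_row :: "complex mat \<Rightarrow> nat \<Rightarrow> complex mat" where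
  "zero_row X j = Matrix.mat (dim_row X) (dim_col X) (\<lambda>(i, k). if i = j then 0 else X $$ (i, k))"

lemma crow_carrier [simp]: "X \<in> carrier_mat n m \<Longrightarrow> crow X j \<in> carrier_vec m"
  by (auto simp: crow_def)

lemma crow_dim [simp]: "dim_vec (crow X j) = dim_col X"
  by (simp add: crow_def)

lemma zero_row_dim [simp]:
  "dim_row (zero_row X j) = dim_row X" "dim_col (zero_row X j) = dim_col X"
  by (simp_all add: zero_row_def)

lemma vec_minus_eq_iff:
  fixes a b c :: "complex Matrix.vec"
  assumes "a \<in> carrier_vec n" "b \<in> carrier_vec n" "c \<in> carrier_vec n"
  shows "a - b = c \<longleftrightarrow> a = b + c"
proof
  assume "a - b = c"
  then show "a = b + c" using assms by (auto intro!: eq_vecI)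
next
  assume "a = b + c"
  then show "a - b = c" using assms by (auto intro!: eq_vecI)
qed

lemma zero_row_carrier [simp]: "X \<in> carrier_mat n m \<Longrightarrow> zero_row X j \<in> carrier_mat n m"
  by (auto simp: zero_row_def)

text \<open>The Gram matrix loses exactly the summand \<open>x\<^sub>j\<^sup>* x\<^sub>j\<close>,
  here written through its action on a vector.\<close>

lemma gram_mult_zero_row:
  assumes X: "X \<in> carrier_mat n n" and j: "j < n" and w: "w \<in> carrier_vec n"
  shows "gram X *\<^sub>v w = gram (zero_row X j) *\<^sub>v w + (w \<bullet>c crow X j) \<cdot>\<^sub>v crow X j"
proof (rule eq_vecI)
  have dims [simp]: "dim_row X = n" "dim_col X = n"
    using X by auto
  show "dim_vec (gram X *\<^sub>v w) = dim_vec (gram (zero_row X j) *\<^sub>v w + (w \<bullet>c crow X j) \<cdot>\<^sub>v crow X j)"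
    by simp
  fix k assume "k < dim_vec (gram (zero_row X j) *\<^sub>v w + (w \<bullet>c crow X j) \<cdot>\<^sub>v crow X j)"
  then have k: "k < n" by simp
  have ent: "gram X $$ (k, l) = gram (zero_row X j) $$ (k, l) + cnj (X $$ (j, k)) * X $$ (j, l)"
    if l: "l < n" for l
  proof -
    have "gram X $$ (k, l) = (\<Sum>i\<in>{..<n}-{j}. cnj (X $$ (i, k)) * X $$ (i, l)) + cnj (X $$ (j, k)) * X $$ (j, l)"
      unfolding gram_index[OF X k l] using j by (subst sum.remove[of _ j]) auto
    also have "(\<Sum>i\<in>{..<n}-{j}. cnj (X $$ (i, k)) * X $$ (i, l)) = gram (zero_row X j) $$ (k, l)"
      unfolding gram_index[OF zero_row_carrier[OF X] k l] using k l
      by (intro sum.mono_neutral_cong_left) (auto simp: zero_row_def)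
    finally show ?thesis .
  qed
  show "(gram X *\<^sub>v w) $ k = (gram (zero_row X j) *\<^sub>v w + (w \<bullet>c crow X j) \<cdot>\<^sub>v crow X j) $ k"
    using k w X
    by (simp add: scalar_prod_def inner_sum ent sum.distrib distrib_right crow_def
        sum_distrib_left sum_distrib_right lessThan_atLeast0 algebra_simps)
qed

lemma mult_minus_shift:
  assumes "A \<in> carrier_mat n n" "w \<in> carrier_vec n"
  shows "(A - (z :: complex) \<cdot>\<^sub>m 1\<^sub>m n) *\<^sub>v w = A *\<^sub>v w - z \<cdot>\<^sub>v w"
  using assms by (subst minus_mult_distrib_mat_vec[of _ n n]) auto

lemma resolvent_shift_mult:
  assumes X: "X \<in> carrier_mat n n" and z: "Im z > 0" and w: "w \<in> carrier_vec n"
  shows "resolvent (gram X) z *\<^sub>v (gram X *\<^sub>v w - z \<cdot>\<^sub>v w) = w"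
    and "gram X *\<^sub>v (resolvent (gram X) z *\<^sub>v w) = z \<cdot>\<^sub>v (resolvent (gram X) z *\<^sub>v w) + w"
proof -
  note [simp] = gram_carrier[OF X] resolvent_carrier[OF gram_carrier[OF X]]
  have B: "gram X - z \<cdot>\<^sub>m 1\<^sub>m n \<in> carrier_mat n n" by auto
  have Rw: "resolvent (gram X) z *\<^sub>v w \<in> carrier_vec n"
    using w by (metis mult_mat_vec_carrier resolvent_carrier gram_carrier X)
  show "resolvent (gram X) z *\<^sub>v (gram X *\<^sub>v w - z \<cdot>\<^sub>v w) = w"
    unfolding mult_minus_shift[OF gram_carrier[OF X] w, symmetric]
    using w B by (subst assoc_mult_mat_vec[of _ n n _ n, symmetric]) (auto simp: resolvent_left[OF X z])
  have "gram X *\<^sub>v (resolvent (gram X) z *\<^sub>v w) - z \<cdot>\<^sub>v (resolvent (gram X) z *\<^sub>v w) = w"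
    unfolding mult_minus_shift[OF gram_carrier[OF X] Rw, symmetric]
    using w B by (subst assoc_mult_mat_vec[of _ n n _ n, symmetric]) (auto simp: resolvent_right[OF X z])
  moreover have "gram X *\<^sub>v (resolvent (gram X) z *\<^sub>v w) \<in> carrier_vec n"
    using Rw X by (meson gram_carrier mult_mat_vec_carrier)
  ultimately show "gram X *\<^sub>v (resolvent (gram X) z *\<^sub>v w) = z \<cdot>\<^sub>v (resolvent (gram X) z *\<^sub>v w) + w"
    using Rw w by (subst (asm) vec_minus_eq_iff[of _ n]) auto
qed

text \<open>This is the resolvent identity \<open>R' - R = R x\<^sub>j\<^sup>* x\<^sub>j R'\<close>
  applied to \<open>a\<close>. It results from applying the shifted Gram matrix of \<open>X\<close>
  to \<open>R' a\<close> and then inverting.\<close>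

lemma resolvent_zero_row:
  assumes X: "X \<in> carrier_mat n n" and z: "Im z > 0" and j: "j < n" and a: "a \<in> carrier_vec n"
  defines "R \<equiv> resolvent (gram X) z" and "R' \<equiv> resolvent (gram (zero_row X j)) z"
  shows "R' *\<^sub>v a = R *\<^sub>v a + ((R' *\<^sub>v a) \<bullet>c crow X j) \<cdot>\<^sub>v (R *\<^sub>v crow X j)"
proof -
  note X' = zero_row_carrier[OF X, of j]
  have Rc: "R \<in> carrier_mat n n" and R'c: "R' \<in> carrier_mat n n"
    using X X' by (simp_all add: R_def R'_def)
  have u: "crow X j \<in> carrier_vec n" using X by simp
  let ?w = "R' *\<^sub>v a"
  have w: "?w \<in> carrier_vec n" using R'c a by simp
  have "gram X *\<^sub>v ?w = (z \<cdot>\<^sub>v ?w + a) + (?w \<bullet>c crow X j) \<cdot>\<^sub>v crow X j"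
    unfolding gram_mult_zero_row[OF X j w]
    unfolding R'_def resolvent_shift_mult(2)[OF X' z a] ..
  then have "gram X *\<^sub>v ?w - z \<cdot>\<^sub>v ?w = a + (?w \<bullet>c crow X j) \<cdot>\<^sub>v crow X j"
    using w a u by (subst vec_minus_eq_iff[of _ n]) (auto simp: assoc_add_vec[of _ n])
  then have "?w = R *\<^sub>v (a + (?w \<bullet>c crow X j) \<cdot>\<^sub>v crow X j)"
    using resolvent_shift_mult(1)[OF X z w] by (simp add: R_def)
  also have "\<dots> = R *\<^sub>v a + (?w \<bullet>c crow X j) \<cdot>\<^sub>v (R *\<^sub>v crow X j)"
    using Rc a u by (simp add: mult_add_distrib_mat_vec[of _ n n] mult_mat_vec[of _ n n])
  finally show ?thesis .
qed

section \<open>Trace identities for the resolvent\<close>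

lemma mat_trace_sum: "A \<in> carrier_mat n n \<Longrightarrow> mat_trace A = (\<Sum>k<n. A $$ (k, k))"
  by (auto simp: mat_trace_def)

lemma mat_trace_mult_commute:
  fixes A B :: "complex mat"
  assumes "A \<in> carrier_mat n n" "B \<in> carrier_mat n n"
  shows "mat_trace (A * B) = mat_trace (B * A)"
proof -
  have "mat_trace (A * B) = (\<Sum>i<n. \<Sum>k<n. A $$ (i, k) * B $$ (k, i))"
    using assms by (auto simp: mat_trace_def scalar_prod_def lessThan_atLeast0)
  also have "\<dots> = (\<Sum>k<n. \<Sum>i<n. A $$ (i, k) * B $$ (k, i))"
    by (rule sum.swap)
  also have "\<dots> = mat_trace (B * A)"
    using assms by (auto simp: mat_trace_def scalar_prod_def lessThan_atLeast0 mult.commute)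
  finally show ?thesis .
qed

lemma mat_trace_minus_smult_one:
  fixes A B :: "complex mat"
  assumes "A \<in> carrier_mat n n" "B \<in> carrier_mat n n" "A - z \<cdot>\<^sub>m B = 1\<^sub>m n"
  shows "z * mat_trace B = mat_trace A - of_nat n"
proof -
  have "A $$ (k, k) - z * B $$ (k, k) = 1" if "k < n" for k
  proof -
    have "(A - z \<cdot>\<^sub>m B) $$ (k, k) = 1" using assms(3) that by simp
    then show ?thesis using assms(1,2) that by simp
  qed
  then have "(\<Sum>k<n. A $$ (k, k) - z * B $$ (k, k)) = of_nat n"
    by simp
  then show ?thesis
    using assms by (simp add: mat_trace_sum sum_subtractf sum_distrib_left algebra_simps)
qed

lemma
  assumes X: "X \<in> carrier_mat n n" and z: "Im z > 0"
  shows resolvent_right': "gram X * resolvent (gram X) z - z \<cdot>\<^sub>m resolvent (gram X) z = 1\<^sub>m n"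
    and resolvent_left': "resolvent (gram X) z * gram X - z \<cdot>\<^sub>m resolvent (gram X) z = 1\<^sub>m n"
proof -
  have S: "gram X \<in> carrier_mat n n" and R: "resolvent (gram X) z \<in> carrier_mat n n"
    using X by simp_all
  have zI: "z \<cdot>\<^sub>m 1\<^sub>m n \<in> carrier_mat n n" by simp
  show "gram X * resolvent (gram X) z - z \<cdot>\<^sub>m resolvent (gram X) z = 1\<^sub>m n"
    using resolvent_right[OF X z] S R
    unfolding minus_mult_distrib_mat[OF S zI R] mult_smult_assoc_mat[OF one_carrier_mat R] by simp
  show "resolvent (gram X) z * gram X - z \<cdot>\<^sub>m resolvent (gram X) z = 1\<^sub>m n"
    using resolvent_left[OF X z] S R
    unfolding mult_minus_distrib_mat[OF R S zI] mult_smult_distrib[OF R one_carrier_mat] by simp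
qed

lemma mat_inverse_eq_resolvent:
  assumes X: "X \<in> carrier_mat n n" and z: "Im z > 0"
  shows "the (mat_inverse (gram X - z \<cdot>\<^sub>m 1\<^sub>m n)) = resolvent (gram X) z"
proof -
  let ?B = "gram X - z \<cdot>\<^sub>m 1\<^sub>m n" and ?R = "resolvent (gram X) z"
  have B: "?B \<in> carrier_mat n n" and R: "?R \<in> carrier_mat n n" using X by auto
  \<comment> \<open>\<open>mat_inverse\<close> returns a value on the units of the matrix ring;
    uniqueness of inverses then identifies this value with the resolvent given by Cramer's
    rule.\<close>
  have "?B \<in> Units (ring_mat TYPE(complex) n ())"
    unfolding Units_def using B R resolvent_right[OF X z] resolvent_left[OF X z]
    by (auto simp: ring_mat_simps)
  then obtain C where C: "mat_inverse ?B = Some C"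
    using mat_inverse(1)[OF B, where b="()"] by (cases "mat_inverse ?B") auto
  then have C': "?B * C = 1\<^sub>m n" "C \<in> carrier_mat n n"
    using mat_inverse(2)[OF B] by auto
  have "?R = ?R * (?B * C)" using C' R by simp
  also have "\<dots> = (?R * ?B) * C" using B R C' by (simp add: assoc_mult_mat[of _ n n _ n _ n])
  also have "\<dots> = C" using C' by (simp add: resolvent_left[OF X z])
  finally show ?thesis using C by simp
qed

text \<open>With \<open>Y = X\<^sup>*\<close>, the resolvents \<open>G\<close> of \<open>X Y\<close>
  and \<open>R\<close> of \<open>Y X\<close> are intertwined: \<open>Y G = R Y\<close>. Hence
  \<open>z tr G + n = tr (X Y G) = tr (X R Y) = tr (R Y X) = z tr R + n\<close>.\<close>

lemma mat_trace_resolvent_adjoint: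
  assumes X: "X \<in> carrier_mat n n" and z: "Im z > 0"
  shows "mat_trace (resolvent (gram (mat_adjoint X)) z) = mat_trace (resolvent (gram X) z)"
proof -
  define Y where "Y = mat_adjoint X"
  define R where "R = resolvent (gram X) z"
  define G where "G = resolvent (gram Y) z"
  have Y: "Y \<in> carrier_mat n n" using X by (simp add: Y_def)
  have gX: "gram X = Y * X" and gY: "gram Y = X * Y"
    by (simp_all add: gram_def Y_def)
  have R: "R \<in> carrier_mat n n" and G: "G \<in> carrier_mat n n" using X Y by (simp_all add: R_def G_def)
  have zI: "z \<cdot>\<^sub>m 1\<^sub>m n \<in> carrier_mat n n" by simp
  have XY: "X * Y \<in> carrier_mat n n" and YX: "Y * X \<in> carrier_mat n n" using X Y by auto
  have BX: "Y * X - z \<cdot>\<^sub>m 1\<^sub>m n \<in> carrier_mat n n" and BY: "X * Y - z \<cdot>\<^sub>m 1\<^sub>m n \<in> carrier_mat n n"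
    by auto
  have comm: "(Y * X - z \<cdot>\<^sub>m 1\<^sub>m n) * Y = Y * (X * Y - z \<cdot>\<^sub>m 1\<^sub>m n)"
    unfolding minus_mult_distrib_mat[OF YX zI Y] mult_minus_distrib_mat[OF Y XY zI]
      mult_smult_assoc_mat[OF one_carrier_mat Y] mult_smult_distrib[OF Y one_carrier_mat]
    using X Y by (simp add: assoc_mult_mat[of _ n n _ n _ n])
  have "Y * G = (R * (Y * X - z \<cdot>\<^sub>m 1\<^sub>m n)) * (Y * G)"
    using resolvent_left[OF X z] Y G by (simp add: R_def gX)
  also have "\<dots> = R * (((Y * X - z \<cdot>\<^sub>m 1\<^sub>m n) * Y) * G)"
    using R BX Y G mult_carrier_mat[OF Y G] by (simp add: assoc_mult_mat[of _ n n _ n _ n])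
  also have "\<dots> = R * (Y * ((X * Y - z \<cdot>\<^sub>m 1\<^sub>m n) * G))"
    unfolding comm using R BY Y G mult_carrier_mat[OF BY G] by (simp add: assoc_mult_mat[of _ n n _ n _ n])
  also have "(X * Y - z \<cdot>\<^sub>m 1\<^sub>m n) * G = 1\<^sub>m n"
    using resolvent_right[OF Y z] by (simp add: G_def gY)
  finally have YG: "Y * G = R * Y" using R Y by simp
  have "z * mat_trace G = mat_trace (X * Y * G) - of_nat n"
    using resolvent_right'[OF Y z] XY G
    by (intro mat_trace_minus_smult_one) (auto simp: G_def gY)
  also have "X * Y * G = X * (R * Y)" using X Y G YG by (simp add: assoc_mult_mat[of _ n n _ n _ n])
  also have "mat_trace (X * (R * Y)) = mat_trace (R * Y * X)"
    using X R Y by (intro mat_trace_mult_commute) auto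
  also have "R * Y * X = R * (Y * X)" using X Y R by (simp add: assoc_mult_mat[of _ n n _ n _ n])
  also have "mat_trace (R * (Y * X)) - of_nat n = z * mat_trace R"
    using resolvent_left'[OF X z] YX R mult_carrier_mat[OF R YX]
    by (intro mat_trace_minus_smult_one[symmetric]) (auto simp: R_def gX)
  finally have "z * mat_trace G = z * mat_trace R" .
  moreover have "z \<noteq> 0" using z by auto
  ultimately show ?thesis by (simp add: G_def R_def Y_def)
qed

text \<open>Take traces in \<open>gram X * R = 1 + z R\<close> and write the Gram matrix as a sum of
  rank-one matrices over the rows.\<close>

lemma mat_trace_gram_resolvent:
  assumes X: "X \<in> carrier_mat n n" and z: "Im z > 0"
  shows "z * mat_trace (resolvent (gram X) z) =
    (\<Sum>j<n. (resolvent (gram X) z *\<^sub>v crow X j) \<bullet>c crow X j) - of_nat n"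
proof -
  define R where "R = resolvent (gram X) z"
  have R: "R \<in> carrier_mat n n" using X by (simp add: R_def)
  note [simp] = carrier_matD[OF X] carrier_matD[OF R]
  have "z * mat_trace R = mat_trace (gram X * R) - of_nat n"
    using resolvent_right'[OF X z] mult_carrier_mat[OF gram_carrier[OF X] R] R
    by (intro mat_trace_minus_smult_one) (simp_all add: R_def)
  also have "mat_trace (gram X * R) = mat_trace (R * gram X)"
    using X R by (intro mat_trace_mult_commute) auto
  also have "\<dots> = (\<Sum>k<n. \<Sum>l<n. R $$ (k, l) * gram X $$ (l, k))"
    using X by (simp add: mat_trace_def scalar_prod_def lessThan_atLeast0)
  also have "\<dots> = (\<Sum>k<n. \<Sum>l<n. \<Sum>j<n. R $$ (k, l) * (cnj (X $$ (j, l)) * X $$ (j, k)))"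
    by (intro sum.cong refl) (auto simp: gram_index[OF X] sum_distrib_left)
  also have "\<dots> = (\<Sum>k<n. \<Sum>j<n. \<Sum>l<n. R $$ (k, l) * (cnj (X $$ (j, l)) * X $$ (j, k)))"
    by (intro sum.cong refl sum.swap)
  also have "\<dots> = (\<Sum>j<n. \<Sum>k<n. \<Sum>l<n. R $$ (k, l) * (cnj (X $$ (j, l)) * X $$ (j, k)))"
    by (rule sum.swap)
  also have "\<dots> = (\<Sum>j<n. (R *\<^sub>v crow X j) \<bullet>c crow X j)"
    unfolding inner_sum
    by (intro sum.cong refl)
       (auto simp: scalar_prod_def crow_def lessThan_atLeast0 sum_distrib_right mult.assoc intro!: sum.cong)
  finally show ?thesis by (simp add: R_def)
qed

section \<open>Resolvent entries: sign, size and dependence on the matrix and on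
  \<open>z\<close>\<close>

lemma mult_unit_vec_index:
  fixes A :: "complex mat"
  assumes "A \<in> carrier_mat n n" "k < n" "l < n"
  shows "(A *\<^sub>v unit_vec n k) $ l = A $$ (l, k)"
proof -
  have "(A *\<^sub>v unit_vec n k) $ l = (\<Sum>i\<in>{0..<n}. A $$ (l, i) * (if i = k then 1 else 0))"
    using assms by (simp add: scalar_prod_def)
  also have "\<dots> = A $$ (l, k)" using assms by (subst sum.remove[of _ k]) auto
  finally show ?thesis .
qed

lemma inner_unit_vec:
  fixes v :: "complex Matrix.vec"
  assumes "k < n" "v \<in> carrier_vec n"
  shows "v \<bullet>c unit_vec n k = v $ k"
proof -
  have "v \<bullet>c unit_vec n k = (\<Sum>i<n. if i = k then v $ k else 0)"
    unfolding inner_sum using assms by (intro sum.cong) (auto simp: index_unit_vec)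
  then show ?thesis using assms(1) by simp
qed

lemma cnorm_unit_vec: "k < n \<Longrightarrow> cnorm (unit_vec n k) = 1"
proof -
  assume k: "k < n"
  have "complex_of_real ((cnorm (unit_vec n k))\<^sup>2) = 1"
    unfolding inner_self[symmetric] using k by (simp add: inner_unit_vec)
  then have "(cnorm (unit_vec n k))\<^sup>2 = 1"
    using of_real_eq_1_iff by blast
  then show ?thesis
    using cnorm_nonneg[of "unit_vec n k"] by (auto simp: power2_eq_1_iff)
qed

lemma resolvent_diag:
  assumes X: "X \<in> carrier_mat n n" and k: "k < n"
  shows "resolvent (gram X) z $$ (k, k) = (resolvent (gram X) z *\<^sub>v unit_vec n k) \<bullet>c unit_vec n k"
proof -
  have R: "resolvent (gram X) z \<in> carrier_mat n n" using X by simp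
  have "resolvent (gram X) z *\<^sub>v unit_vec n k \<in> carrier_vec n"
    using R by auto
  then show ?thesis using R k by (simp add: mult_unit_vec_index inner_unit_vec)
qed

lemma resolvent_trace_Im:
  assumes X: "X \<in> carrier_mat n n" and z: "Im z > 0"
  shows "Im (mat_trace (resolvent (gram X) z)) \<ge> 0"
  using X z
  by (simp add: mat_trace_sum[of _ n] resolvent_diag sum_nonneg resolvent_inner_Im[OF X z])

text \<open>Column \<open>k\<close> is the resolvent applied to a unit vector, so its norm is at
  most \<open>1 / Im z\<close>; there are \<open>n\<close> columns.\<close>

lemma resolvent_Frobenius_le:
  assumes X: "X \<in> carrier_mat n n" and z: "Im z > 0"
  shows "(\<Sum>k<n. \<Sum>l<n. (cmod (resolvent (gram X) z $$ (l, k)))\<^sup>2) \<le> of_nat n / (Im z)\<^sup>2"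
proof -
  have R: "resolvent (gram X) z \<in> carrier_mat n n" using X by simp
  have "(\<Sum>l<n. (cmod (resolvent (gram X) z $$ (l, k)))\<^sup>2) \<le> 1 / (Im z)\<^sup>2" if k: "k < n" for k
  proof -
    have "(\<Sum>l<n. (cmod (resolvent (gram X) z $$ (l, k)))\<^sup>2) = (cnorm (resolvent (gram X) z *\<^sub>v unit_vec n k))\<^sup>2"
      using R k by (auto simp: cnorm_sq mult_unit_vec_index[OF R k])
    also have "\<dots> \<le> (1 / Im z)\<^sup>2"
      using resolvent_norm_le[OF X z unit_vec_carrier, of k] cnorm_unit_vec[OF k]
      by (intro power_mono) auto
    finally show ?thesis by (simp add: power_divide)
  qed
  then have "(\<Sum>k<n. \<Sum>l<n. (cmod (resolvent (gram X) z $$ (l, k)))\<^sup>2) \<le> (\<Sum>k<n. 1 / (Im z)\<^sup>2)"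
    by (intro sum_mono) auto
  then show ?thesis by simp
qed

text \<open>By \<open>resolvent_zero_row\<close> the difference is the trace of
  \<open>R u u\<^sup>* R'\<close>, that is, the inner product of \<open>R' R u\<close> with
  \<open>u\<close>. Each resolvent costs a factor \<open>1 / Im z\<close>, and no power of
  \<open>n\<close> appears.\<close>

lemma resolvent_trace_zero_row:
  assumes X: "X \<in> carrier_mat n n" and z: "Im z > 0" and j: "j < n"
  shows "cmod (mat_trace (resolvent (gram (zero_row X j)) z) - mat_trace (resolvent (gram X) z))
    \<le> (cnorm (crow X j))\<^sup>2 / (Im z)\<^sup>2"
proof -
  define R R' u where "R = resolvent (gram X) z" and "R' = resolvent (gram (zero_row X j)) z"
    and "u = crow X j"
  note X' = zero_row_carrier[OF X, of j]
  have R: "R \<in> carrier_mat n n" and R': "R' \<in> carrier_mat n n" and u: "u \<in> carrier_vec n"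
    using X X' by (simp_all add: R_def R'_def u_def)
  have [simp]: "dim_row R = n" "dim_col R = n" "dim_row R' = n" "dim_col R' = n" "dim_vec u = n"
    using R R' u by auto
  have Ru: "R *\<^sub>v u \<in> carrier_vec n" using R u by simp
  have "R' $$ (k, k) - R $$ (k, k) = (\<Sum>l<n. R' $$ (l, k) * (R *\<^sub>v u) $ k * cnj (u $ l))" if k: "k < n" for k
  proof -
    have "R' *\<^sub>v unit_vec n k = R *\<^sub>v unit_vec n k + ((R' *\<^sub>v unit_vec n k) \<bullet>c u) \<cdot>\<^sub>v (R *\<^sub>v u)"
      using resolvent_zero_row[OF X z j, of "unit_vec n k"] by (simp add: R_def R'_def u_def)
    then have "(R' *\<^sub>v unit_vec n k) $ k =
        (R *\<^sub>v unit_vec n k + ((R' *\<^sub>v unit_vec n k) \<bullet>c u) \<cdot>\<^sub>v (R *\<^sub>v u)) $ k"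
      by (rule arg_cong)
    also have "\<dots> = (R *\<^sub>v unit_vec n k) $ k + ((R' *\<^sub>v unit_vec n k) \<bullet>c u) * (R *\<^sub>v u) $ k"
      using k by simp
    finally show ?thesis
      using k R R' by (simp add: mult_unit_vec_index inner_sum sum_distrib_right del: index_mult_mat_vec)
        (auto simp: mult_unit_vec_index mult_ac simp del: index_mult_mat_vec intro!: sum.cong)
  qed
  then have "mat_trace R' - mat_trace R = (\<Sum>k<n. \<Sum>l<n. R' $$ (l, k) * (R *\<^sub>v u) $ k * cnj (u $ l))"
    using R R' by (simp add: mat_trace_sum sum_subtractf[symmetric] del: index_mult_mat_vec)
  also have "\<dots> = (\<Sum>l<n. \<Sum>k<n. R' $$ (l, k) * (R *\<^sub>v u) $ k * cnj (u $ l))"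
    by (rule sum.swap)
  also have "\<dots> = (R' *\<^sub>v (R *\<^sub>v u)) \<bullet>c u"
    unfolding inner_sum
    by (auto simp: scalar_prod_def sum_distrib_right lessThan_atLeast0 intro!: sum.cong)
  finally have "cmod (mat_trace R' - mat_trace R) \<le> cnorm (R' *\<^sub>v (R *\<^sub>v u)) * cnorm u"
    using inner_Cauchy_Schwarz[of "R' *\<^sub>v (R *\<^sub>v u)" u] by simp
  also have "cnorm (R' *\<^sub>v (R *\<^sub>v u)) \<le> cnorm (R *\<^sub>v u) / Im z"
    unfolding R'_def by (rule resolvent_norm_le[OF X' z Ru])
  also have "cnorm (R *\<^sub>v u) \<le> cnorm u / Im z"
    unfolding R_def by (rule resolvent_norm_le[OF X z u])
  finally show ?thesis using z
    by (simp add: R_def R'_def u_def power2_eq_square divide_right_mono mult_right_mono)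
qed

lemma vec_shift_diff:
  fixes g w e :: "complex Matrix.vec"
  assumes "g = z' \<cdot>\<^sub>v w + e" "w \<in> carrier_vec n" "e \<in> carrier_vec n"
  shows "g - z \<cdot>\<^sub>v w = e + (z' - z) \<cdot>\<^sub>v w"
  using assms by (intro eq_vecI) (auto simp: algebra_simps)

text \<open>The diagonal of the resolvent identity \<open>R' - R = (z' - z) R R'\<close>, with each
  resolvent bounded by its inverse height. It later carries the estimate from grid points to the
  whole domain.\<close>

lemma resolvent_trace_Lipschitz:
  assumes X: "X \<in> carrier_mat n n" and z: "Im z > 0" and z': "Im z' > 0"
  shows "cmod (mat_trace (resolvent (gram X) z) - mat_trace (resolvent (gram X) z'))
    \<le> of_nat n * cmod (z - z') / (Im z * Im z')"
proof -
  define R R' where "R = resolvent (gram X) z" and "R' = resolvent (gram X) z'"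
  have R: "R \<in> carrier_mat n n" and R': "R' \<in> carrier_mat n n"
    using X by (simp_all add: R_def R'_def)
  have S: "gram X \<in> carrier_mat n n" using X by simp
  have "cmod (R $$ (k, k) - R' $$ (k, k)) \<le> cmod (z - z') / (Im z * Im z')" if k: "k < n" for k
  proof -
    let ?e = "unit_vec n k :: complex Matrix.vec"
    let ?w = "R' *\<^sub>v ?e"
    have e: "?e \<in> carrier_vec n" by simp
    have w: "?w \<in> carrier_vec n" using R' by auto
    have Rw: "R *\<^sub>v ?w \<in> carrier_vec n" using R w by auto
    have "gram X *\<^sub>v ?w - z \<cdot>\<^sub>v ?w = ?e + (z' - z) \<cdot>\<^sub>v ?w"
      using w e resolvent_shift_mult(2)[OF X z' e] by (intro vec_shift_diff) (auto simp: R'_def)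
    then have "?w = R *\<^sub>v (?e + (z' - z) \<cdot>\<^sub>v ?w)"
      using resolvent_shift_mult(1)[OF X z w] by (simp add: R_def)
    also have "\<dots> = R *\<^sub>v ?e + (z' - z) \<cdot>\<^sub>v (R *\<^sub>v ?w)"
      using R w by (simp add: mult_add_distrib_mat_vec[of _ n n] mult_mat_vec[of _ n n])
    finally have "?w $ k = (R *\<^sub>v ?e + (z' - z) \<cdot>\<^sub>v (R *\<^sub>v ?w)) $ k"
      by (rule arg_cong)
    then have "?w $ k = (R *\<^sub>v ?e) $ k + (z' - z) * (R *\<^sub>v ?w) $ k"
      using k R by (simp del: index_mult_mat_vec)
    then have "R' $$ (k, k) - R $$ (k, k) = (z' - z) * ((R *\<^sub>v ?w) \<bullet>c ?e)"
      using k R R' Rw by (simp add: mult_unit_vec_index inner_unit_vec del: index_mult_mat_vec)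
    then have "cmod (R $$ (k, k) - R' $$ (k, k)) = cmod (z - z') * cmod ((R *\<^sub>v ?w) \<bullet>c ?e)"
      by (metis norm_minus_commute norm_mult)
    also have "cmod ((R *\<^sub>v ?w) \<bullet>c ?e) \<le> cnorm (R *\<^sub>v ?w) * cnorm ?e"
      using R by (intro inner_Cauchy_Schwarz) auto
    also have "\<dots> \<le> 1 / (Im z * Im z')"
    proof -
      have "cnorm (R *\<^sub>v ?w) \<le> cnorm ?w / Im z"
        unfolding R_def by (rule resolvent_norm_le[OF X z w])
      moreover have "cnorm ?w \<le> 1 / Im z'"
        using resolvent_norm_le[OF X z' e] cnorm_unit_vec[OF k] by (simp add: R'_def)
      ultimately have "cnorm (R *\<^sub>v ?w) \<le> (1 / Im z') / Im z"
        using z by (meson divide_right_mono less_imp_le order_trans)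
      then show ?thesis using cnorm_unit_vec[OF k] by (simp add: mult.commute)
    qed
    finally show ?thesis by (simp add: mult_left_mono)
  qed
  then have "cmod (mat_trace R - mat_trace R') \<le> (\<Sum>k<n. cmod (z - z') / (Im z * Im z'))"
    using R R' by (simp only: mat_trace_sum sum_subtractf[symmetric]) (rule sum_norm_le, auto)
  then show ?thesis by (simp add: R_def R'_def)
qed

subsection \<open>The self-consistent equation\<close>

text \<open>Here \<open>row_form\<close> is \<open>q\<^sub>j\<close>; the vector \<open>crow X j\<close> is the column vector \<open>x\<^sub>j\<^sup>*\<close>.\<close>

definition row_form :: "complex mat \<Rightarrow> complex \<Rightarrow> nat \<Rightarrow> complex" where
  "row_form X z j = (resolvent (gram (zero_row X j)) z *\<^sub>v crow X j) \<bullet>c crow X j"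

definition row_dev :: "complex mat \<Rightarrow> complex \<Rightarrow> nat \<Rightarrow> complex" where
  "row_dev X z j = row_form X z j - mat_trace (resolvent (gram (zero_row X j)) z) / of_nat (dim_row X)"

text \<open>As \<open>z q\<^sub>j\<close> has non-negative imaginary part,
  \<open>z (1 + q\<^sub>j)\<close> has imaginary part at least \<open>Im z\<close>. This controls
  the denominators of the Sherman-Morrison formula.\<close>

lemma row_form_lower:
  assumes X: "X \<in> carrier_mat n n" and z: "Im z > 0"
  shows "Im z / cmod z \<le> cmod (1 + row_form X z j)"
proof -
  have "Im z \<le> Im (z * (1 + row_form X z j))"
    using resolvent_inner_Im_mult[OF zero_row_carrier[OF X, of j] z crow_carrier[OF X, of j]]
    by (simp add: row_form_def algebra_simps)
  also have "\<dots> \<le> cmod z * cmod (1 + row_form X z j)"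
    by (metis abs_Im_le_cmod abs_le_D1 norm_mult)
  finally show ?thesis using z by (cases "z = 0") (simp_all add: pos_divide_le_eq mult.commute)
qed

lemma row_form_neq:
  assumes X: "X \<in> carrier_mat n n" and z: "Im z > 0"
  shows "1 + row_form X z j \<noteq> 0"
proof -
  have "0 < Im z / cmod z" using z by (cases "z = 0") auto
  then show ?thesis using row_form_lower[OF X z, of j] by auto
qed

text \<open>With \<open>p = x\<^sub>j R x\<^sub>j\<^sup>*\<close>, the case
  \<open>a = x\<^sub>j\<^sup>*\<close> of \<open>resolvent_zero_row\<close> reads
  \<open>q\<^sub>j = (1 + q\<^sub>j) p\<close>.\<close>

lemma resolvent_row_form:
  assumes X: "X \<in> carrier_mat n n" and z: "Im z > 0" and j: "j < n"
  shows "(resolvent (gram X) z *\<^sub>v crow X j) \<bullet>c crow X j = 1 - 1 / (1 + row_form X z j)"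
proof -
  define R R' u q where "R = resolvent (gram X) z" and "R' = resolvent (gram (zero_row X j)) z"
    and "u = crow X j" and "q = row_form X z j"
  have R: "R \<in> carrier_mat n n" and u: "u \<in> carrier_vec n"
    using X by (simp_all add: R_def u_def)
  have Ru: "R *\<^sub>v u \<in> carrier_vec n" using R u by simp
  have "R' *\<^sub>v u = R *\<^sub>v u + q \<cdot>\<^sub>v (R *\<^sub>v u)"
    using resolvent_zero_row[OF X z j crow_carrier[OF X, of j]]
    by (simp add: R_def R'_def u_def q_def row_form_def)
  then have "q = (R *\<^sub>v u + q \<cdot>\<^sub>v (R *\<^sub>v u)) \<bullet>c u"
    by (simp add: q_def row_form_def R'_def u_def)
  also have "\<dots> = (1 + q) * ((R *\<^sub>v u) \<bullet>c u)"
    using Ru u by (simp add: add_scalar_prod_distrib[of _ n] algebra_simps)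
  finally have "q = (1 + q) * ((R *\<^sub>v u) \<bullet>c u)" .
  moreover have "1 + q \<noteq> 0"
    unfolding q_def by (rule row_form_neq[OF X z])
  ultimately show ?thesis
    by (simp add: R_def u_def q_def[symmetric] field_simps)
qed

text \<open>The trace identity gives that \<open>z m\<close> is minus the average of
  \<open>1 / (1 + q\<^sub>j)\<close>. The summands on the right are
  \<open>1 - (1 + m) / (1 + q\<^sub>j)\<close>, so their average is
  \<open>1 + (1 + m) z m\<close>.\<close>

lemma resolvent_self_consistent:
  assumes X: "X \<in> carrier_mat n n" and z: "Im z > 0" and n: "n > 0"
  defines "m \<equiv> mat_trace (resolvent (gram X) z) / of_nat n"
  shows "z * m\<^sup>2 + z * m + 1 = (\<Sum>j<n. (row_form X z j - m) / (1 + row_form X z j)) / of_nat n"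
proof -
  have nz: "1 + row_form X z j \<noteq> 0" for j
    by (rule row_form_neq[OF X z])
  have zm: "z * m = - (\<Sum>j<n. 1 / (1 + row_form X z j)) / of_nat n"
    using mat_trace_gram_resolvent[OF X z] resolvent_row_form[OF X z]
    by (simp add: m_def sum_subtractf)
  have "(row_form X z j - m) / (1 + row_form X z j) = 1 - (1 + m) * (1 / (1 + row_form X z j))" for j
    using nz[of j] by (simp add: field_simps)
  then have "(\<Sum>j<n. (row_form X z j - m) / (1 + row_form X z j)) / of_nat n =
      (of_nat n - (1 + m) * (\<Sum>j<n. 1 / (1 + row_form X z j))) / of_nat n"
    by (simp add: sum_subtractf sum_distrib_left)
  also have "\<dots> = 1 + (1 + m) * (z * m)"
    using n by (simp add: zm diff_divide_distrib)
  finally show ?thesis by (simp add: algebra_simps power2_eq_square)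
qed

text \<open>The difference \<open>q\<^sub>j - m\<close> splits into \<open>row_dev\<close> and the
  change of the normalised trace when row \<open>j\<close> is restored; for unit rows the latter is
  at most \<open>1 / (n (Im z)\<^sup>2)\<close>.\<close>

lemma resolvent_self_consistent_bound:
  assumes X: "X \<in> carrier_mat n n" and z: "Im z > 0" and n: "n > 0"
    and unit: "\<And>j. j < n \<Longrightarrow> cnorm (crow X j) = 1"
  defines "m \<equiv> mat_trace (resolvent (gram X) z) / of_nat n"
  shows "cmod (z * m\<^sup>2 + z * m + 1) \<le>
    cmod z / Im z * ((\<Sum>j<n. cmod (row_dev X z j)) / real n + 1 / (real n * (Im z)\<^sup>2))"
proof -
  have z0: "cmod z > 0" using z by auto
  have "cmod ((row_form X z j - m) / (1 + row_form X z j)) \<le>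
      cmod z / Im z * (cmod (row_dev X z j) + 1 / (real n * (Im z)\<^sup>2))" if j: "j < n" for j
  proof -
    define t where "t = mat_trace (resolvent (gram (zero_row X j)) z)"
    have "cmod (t - mat_trace (resolvent (gram X) z)) \<le> 1 / (Im z)\<^sup>2"
      using resolvent_trace_zero_row[OF X z j] unit[OF j] by (simp add: t_def)
    then have "cmod (t / of_nat n - m) \<le> 1 / (real n * (Im z)\<^sup>2)"
      using n by (simp add: m_def diff_divide_distrib[symmetric] norm_divide field_simps)
    moreover have "row_form X z j - m = row_dev X z j + (t / of_nat n - m)"
      using X by (simp add: row_dev_def t_def)
    ultimately have "cmod (row_form X z j - m) \<le> cmod (row_dev X z j) + 1 / (real n * (Im z)\<^sup>2)"
      by (smt (verit) norm_triangle_ineq)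
    moreover have "1 / cmod (1 + row_form X z j) \<le> cmod z / Im z"
      using row_form_lower[OF X z, of j] z z0
      by (metis divide_pos_pos frac_le inverse_divide inverse_eq_divide less_eq_real_def zero_le_one order_refl)
    ultimately have "cmod (row_form X z j - m) * (1 / cmod (1 + row_form X z j)) \<le>
        (cmod (row_dev X z j) + 1 / (real n * (Im z)\<^sup>2)) * (cmod z / Im z)"
      by (intro mult_mono) auto
    then show ?thesis by (simp add: norm_divide mult.commute)
  qed
  then have "cmod (\<Sum>j<n. (row_form X z j - m) / (1 + row_form X z j)) \<le>
      (\<Sum>j<n. cmod z / Im z * (cmod (row_dev X z j) + 1 / (real n * (Im z)\<^sup>2)))"
    by (intro sum_norm_le) auto
  also have "\<dots> = cmod z / Im z * ((\<Sum>j<n. cmod (row_dev X z j)) + real n * (1 / (real n * (Im z)\<^sup>2)))"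
    by (simp add: sum.distrib sum_distrib_left distrib_left)
  finally have "cmod (\<Sum>j<n. (row_form X z j - m) / (1 + row_form X z j)) / real n \<le>
      (cmod z / Im z * ((\<Sum>j<n. cmod (row_dev X z j)) + real n * (1 / (real n * (Im z)\<^sup>2)))) / real n"
    using n by (intro divide_right_mono) auto
  also have "\<dots> = cmod z / Im z * ((\<Sum>j<n. cmod (row_dev X z j)) / real n + 1 / (real n * (Im z)\<^sup>2))"
    using n by (simp add: field_simps)
  finally show ?thesis
    unfolding m_def resolvent_self_consistent[OF X z n] by (simp add: norm_divide)
qed

text \<open>The other root \<open>-1 - m\<^sub>1\<close> of the quadratic equation lies in the lower half plane,
  at distance at least \<open>c\<close> from every point of the upper half plane.\<close>

lemma quadratic_stability:
  fixes z m m\<^sub>1 :: complex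
  assumes z: "z \<noteq> 0" and root: "z * m\<^sub>1\<^sup>2 + z * m\<^sub>1 + 1 = 0"
    and c: "0 < c" "c \<le> Im m\<^sub>1" and m: "0 \<le> Im m"
  shows "cmod (m - m\<^sub>1) \<le> cmod (z * m\<^sup>2 + z * m + 1) / (c * cmod z)"
proof -
  have "z * ((m - m\<^sub>1) * (m + 1 + m\<^sub>1)) = (z * m\<^sup>2 + z * m + 1) - (z * m\<^sub>1\<^sup>2 + z * m\<^sub>1 + 1)"
    by (simp add: algebra_simps power2_eq_square)
  then have eq: "cmod z * (cmod (m - m\<^sub>1) * cmod (m + 1 + m\<^sub>1)) = cmod (z * m\<^sup>2 + z * m + 1)"
    using root by (metis diff_zero norm_mult)
  have "c \<le> cmod (m + 1 + m\<^sub>1)"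
    using c m abs_Im_le_cmod[of "m + 1 + m\<^sub>1"] by simp
  then have "cmod z * (cmod (m - m\<^sub>1) * c) \<le> cmod (z * m\<^sup>2 + z * m + 1)"
    unfolding eq[symmetric] by (intro mult_left_mono) auto
  then show ?thesis using z c by (simp add: field_simps)
qed

text \<open>Stability applied to the error bound. The factor \<open>cmod z\<close> lost in the
  denominators \<open>1 + q\<^sub>j\<close> cancels against the leading coefficient of the
  quadratic.\<close>

lemma resolvent_trace_near_root:
  assumes X: "X \<in> carrier_mat n n" and z: "Im z > 0" and n: "n > 0"
    and unit: "\<And>j. j < n \<Longrightarrow> cnorm (crow X j) = 1"
    and root: "z * m\<^sub>1\<^sup>2 + z * m\<^sub>1 + 1 = 0" and c: "0 < c" "c \<le> Im m\<^sub>1"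
  shows "cmod (mat_trace (resolvent (gram X) z) / of_nat n - m\<^sub>1) \<le>
    ((\<Sum>j<n. cmod (row_dev X z j)) / real n + 1 / (real n * (Im z)\<^sup>2)) / (c * Im z)"
proof -
  let ?m = "mat_trace (resolvent (gram X) z) / of_nat n"
  have z0: "z \<noteq> 0" using z by auto
  have "0 \<le> Im ?m" using resolvent_trace_Im[OF X z] n by simp
  then have "cmod (?m - m\<^sub>1) \<le> cmod (z * ?m\<^sup>2 + z * ?m + 1) / (c * cmod z)"
    by (rule quadratic_stability[OF z0 root c])
  also have "\<dots> \<le> (cmod z / Im z * ((\<Sum>j<n. cmod (row_dev X z j)) / real n + 1 / (real n * (Im z)\<^sup>2))) / (c * cmod z)"
    using resolvent_self_consistent_bound[OF X z n unit] c by (intro divide_right_mono) auto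
  also have "\<dots> = ((\<Sum>j<n. cmod (row_dev X z j)) / real n + 1 / (real n * (Im z)\<^sup>2)) / (c * Im z)"
    using z0 by simp
  finally show ?thesis .
qed

section \<open>The random exponential matrix and its empirical transform\<close>

lemma X_mat_carrier [simp]: "X_mat N d w \<in> carrier_mat N N"
  by (simp add: X_mat_def)

lemma X_mat_dim [simp]: "dim_row (X_mat N d w) = N" "dim_col (X_mat N d w) = N"
  by (simp_all add: X_mat_def)

lemma X_mat_index:
  "j < N \<Longrightarrow> k < N \<Longrightarrow> X_mat N d w $$ (j, k) =
     of_real (1 / sqrt (real N)) * cis (2 * pi * (\<Sum>q = 1..d. w (j + 1) q * real (k + 1) ^ q))"
  by (simp add: X_mat_def cis_conv_exp mult_ac)

lemma cnorm_crow_X_mat: "j < N \<Longrightarrow> cnorm (crow (X_mat N d w) j) = 1"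
proof -
  assume j: "j < N"
  have "(cnorm (crow (X_mat N d w) j))\<^sup>2 = (\<Sum>k<N. 1 / real N)"
    using j by (simp add: cnorm_sq crow_def X_mat_index norm_mult power_divide norm_divide)
  then have "(cnorm (crow (X_mat N d w) j))\<^sup>2 = 1" using j by simp
  then show ?thesis
    using cnorm_nonneg[of "crow (X_mat N d w) j"] by (auto simp: power2_eq_1_iff)
qed

text \<open>\<open>X X\<^sup>*\<close> is the Gram matrix of \<open>X\<^sup>*\<close>, and passing
  to the adjoint does not change the trace of the resolvent.\<close>

lemma m_emp_eq_resolvent:
  assumes "Im z > 0"
  shows "m_emp N d w z = mat_trace (resolvent (gram (X_mat N d w)) z) / of_nat N"
proof -
  have "X_mat N d w * mat_adjoint (X_mat N d w) = gram (mat_adjoint (X_mat N d w))"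
    by (simp add: gram_def)
  then show ?thesis
    using assms by (simp add: m_emp_def Let_def mat_inverse_eq_resolvent[of _ N] mat_trace_resolvent_adjoint[of _ N])
qed

lemma m_emp_Lipschitz:
  assumes "Im z > 0" "Im z' > 0" "N > 0"
  shows "cmod (m_emp N d w z - m_emp N d w z') \<le> cmod (z - z') / (Im z * Im z')"
proof -
  have "cmod (m_emp N d w z - m_emp N d w z') =
      cmod (mat_trace (resolvent (gram (X_mat N d w)) z) - mat_trace (resolvent (gram (X_mat N d w)) z')) / real N"
    using assms by (simp add: m_emp_eq_resolvent diff_divide_distrib[symmetric] norm_divide)
  also have "\<dots> \<le> (of_nat N * cmod (z - z') / (Im z * Im z')) / real N"
    using assms by (intro divide_right_mono resolvent_trace_Lipschitz[OF X_mat_carrier]) auto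
  finally show ?thesis using assms by simp
qed

subsection \<open>The Stieltjes transform of the Marchenko--Pastur law\<close>

text \<open>The two solutions of \<open>s + 1 / s = z - 2\<close> have product 1. Neither is on the
  unit circle, where they would be conjugate and \<open>z\<close> real; hence one lies
  inside.\<close>

lemma joukowski_root:
  assumes z: "Im z > 0"
  obtains s :: complex where "s \<noteq> 0" "cmod s < 1" "z = 2 + s + 1 / s"
proof -
  define a where "a = z - 2"
  define w where "w = csqrt (a\<^sup>2 - 4)"
  define s\<^sub>1 s\<^sub>2 where "s\<^sub>1 = (a + w) / 2" and "s\<^sub>2 = (a - w) / 2"
  have "s\<^sub>1 * s\<^sub>2 = (a + w) * (a - w) / 4"
    by (simp add: s\<^sub>1_def s\<^sub>2_def)
  also have "(a + w) * (a - w) = a\<^sup>2 - w\<^sup>2"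
    by (simp add: power2_eq_square algebra_simps)
  also have "\<dots> = 4" unfolding w_def power2_csqrt by (rule diff_diff_eq2[THEN trans]) simp
  finally have prod: "s\<^sub>1 * s\<^sub>2 = 1" by simp
  have "s\<^sub>1 + s\<^sub>2 = a" by (simp add: s\<^sub>1_def s\<^sub>2_def field_simps)
  then have sum: "s\<^sub>1 + s\<^sub>2 = z - 2" by (simp only: a_def)
  from prod have nz: "s\<^sub>1 \<noteq> 0" "s\<^sub>2 \<noteq> 0" by auto
  have inv: "s\<^sub>2 = 1 / s\<^sub>1" "s\<^sub>1 = 1 / s\<^sub>2" using prod nz
    by (metis nonzero_mult_div_cancel_left, metis nonzero_mult_div_cancel_right)
  have "cmod s\<^sub>1 \<noteq> 1"
  proof
    assume "cmod s\<^sub>1 = 1"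
    then have "s\<^sub>1 * cnj s\<^sub>1 = 1" using complex_norm_square[of s\<^sub>1] by simp
    then have "s\<^sub>2 = cnj s\<^sub>1" using prod nz(1) by (metis mult_left_cancel)
    then have "Im (s\<^sub>1 + s\<^sub>2) = 0" by simp
    then show False using sum z by simp
  qed
  moreover have "cmod s\<^sub>1 * cmod s\<^sub>2 = 1" using prod by (metis norm_mult norm_one)
  ultimately have "cmod s\<^sub>1 < 1 \<or> cmod s\<^sub>2 < 1"
    using mult_left_mono[of 1 "cmod s\<^sub>2" "cmod s\<^sub>1"] by linarith
  then show ?thesis
  proof
    assume "cmod s\<^sub>1 < 1"
    moreover have "z = 2 + s\<^sub>1 + 1 / s\<^sub>1" using sum unfolding inv(1) by (simp add: add.assoc)
    ultimately show ?thesis using that[of s\<^sub>1] nz by blast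
  next
    assume "cmod s\<^sub>2 < 1"
    moreover have "z = 2 + s\<^sub>2 + 1 / s\<^sub>2" using sum inv(2) by (metis add.assoc add.commute diff_add_cancel)
    ultimately show ?thesis using that[of s\<^sub>2] nz by blast
  qed
qed

text \<open>Keeps the arguments of both logarithms in \<open>MP_primitive\<close> off the branch cut
  for every real \<tau>.\<close>

lemma one_minus_in_slit_plane:
  assumes "cmod s < 1" "cmod w = 1"
  shows "1 - s * w \<notin> \<real>\<^sub>\<le>\<^sub>0" "1 - s * w \<noteq> 0"
proof -
  have "Re (s * w) < 1"
    using assms complex_Re_le_cmod[of "s * w"] by (simp add: norm_mult)
  then show "1 - s * w \<notin> \<real>\<^sub>\<le>\<^sub>0" by (auto simp: complex_nonpos_Reals_iff)
  then show "1 - s * w \<noteq> 0" by auto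
qed

text \<open>After the substitutions \<open>x = 2 + 2 cos \<tau>\<close> and \<open>z = 2 + s + 1 / s\<close> the integrand of \<open>m\<^sub>M\<^sub>P\<close>
  has partial fractions in \<open>exp (\<i> \<tau>)\<close>, which integrate to logarithms.\<close>

definition MP_primitive :: "complex \<Rightarrow> complex \<Rightarrow> complex" where
  "MP_primitive s \<tau> = ((1 - s) / (1 + s) * (\<tau> + \<i> * Ln (1 - s * exp (\<i> * \<tau>)) - \<i> * Ln (1 - s * exp (- \<i> * \<tau>))) - \<tau>)
     / (2 * of_real pi)"

text \<open>In terms of \<open>w = exp (\<i> t)\<close> the logarithms contribute
  \<open>s w / (1 - s w)\<close> and \<open>(s / w) / (1 - s / w)\<close>, and the claim becomes an
  identity of rational functions of \<open>w\<close>.\<close>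

lemma MP_primitive_deriv:
  assumes s: "s \<noteq> 0" "cmod s < 1" and z: "z = 2 + s + 1 / s"
  shows "((\<lambda>t. MP_primitive s (complex_of_real t)) has_vector_derivative
      (1 - of_real (cos t)) / (of_real pi * (2 + 2 * of_real (cos t) - z))) (at t)"
proof -
  define w where "w = exp (\<i> * complex_of_real t)"
  have w': "exp (- (\<i> * complex_of_real t)) = 1 / w" by (simp add: w_def exp_minus inverse_eq_divide)
  have nw: "cmod w = 1" "cmod (1 / w) = 1" "w \<noteq> 0" by (simp_all add: w_def norm_divide)
  have 1: "1 - s * w \<notin> \<real>\<^sub>\<le>\<^sub>0" "1 - s * w \<noteq> 0" and 2: "1 - s * (1 / w) \<notin> \<real>\<^sub>\<le>\<^sub>0" "1 - s * (1 / w) \<noteq> 0"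
    using one_minus_in_slit_plane[OF s(2)] nw by blast+
  have s1: "1 + s \<noteq> 0" using s by (metis add_eq_0_iff norm_minus_cancel norm_one less_irrefl)
  have ws: "w - s \<noteq> 0" using nw s by auto
  have cos: "complex_of_real (cos t) = (w + 1 / w) / 2"
    by (simp add: w_def cos_of_real[symmetric] cos_exp_eq exp_minus inverse_eq_divide)
  have shifted: "((\<lambda>\<tau>. (a * (\<tau> + \<i> * f \<tau> - \<i> * g \<tau>) - \<tau>) / (2 * of_real pi)) has_field_derivative
      (a * (1 + \<i> * f' - \<i> * g') - 1) / (2 * of_real pi)) (at \<sigma>)"
    if "(f has_field_derivative f') (at \<sigma>)" "(g has_field_derivative g') (at \<sigma>)"
    for a f f' g g' and \<sigma> :: complex
    by (rule derivative_eq_intros that refl | simp)+ (simp add: field_simps)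
  define A B where "A = s * w / (1 - s * w)" and "B = s * (1 / w) / (1 - s * (1 / w))"
  have d1: "((\<lambda>\<tau>. Ln (1 - s * exp (\<i> * \<tau>))) has_field_derivative - (\<i> * A)) (at (complex_of_real t))"
    using 1(1) by (auto intro!: derivative_eq_intros simp: w_def[symmetric] inverse_eq_divide mult_ac A_def)
  have d2: "((\<lambda>\<tau>. Ln (1 - s * exp (- \<i> * \<tau>))) has_field_derivative \<i> * B) (at (complex_of_real t))"
    using 2(1) by (auto intro!: derivative_eq_intros simp: w' inverse_eq_divide mult_ac B_def)
  have "(MP_primitive s has_field_derivative
     (((1 - s) / (1 + s) * (1 + A + B) - 1) / (2 * of_real pi))) (at (complex_of_real t))"
    unfolding MP_primitive_def
    using shifted[OF d1 d2, of "(1 - s) / (1 + s)"] by simp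
  then have "(MP_primitive s has_field_derivative
     (((1 - s) / (1 + s) * (1 + s * w / (1 - s * w) + s * (1 / w) / (1 - s * (1 / w))) - 1)
     / (2 * of_real pi))) (at (complex_of_real t))"
    unfolding A_def B_def .
  moreover have "(((1 - s) / (1 + s) * (1 + s * w / (1 - s * w) + s * (1 / w) / (1 - s * (1 / w))) - 1)
     / (2 * of_real pi)) = (1 - of_real (cos t)) / (of_real pi * (2 + 2 * of_real (cos t) - z))"
  proof -
    \<comment> \<open>The common denominator: \<open>2 + 2 cos t - z\<close> equals
      \<open>- P / (s w)\<close>, and the three summands of the derivative add up to
      \<open>(1 - s\<^sup>2) w / P\<close>.\<close>
    define P where "P = (1 - s * w) * (w - s)"
    have P: "P \<noteq> 0" using 1 ws by (simp add: P_def)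
    have d: "2 + 2 * of_real (cos t) - z = - P / (s * w)"
      using s nw by (simp add: cos z P_def field_simps)
    have e1: "1 + s * w / (1 - s * w) + s * (1 / w) / (1 - s * (1 / w)) = (1 - s * s) * w / P"
      using 1 2 ws nw by (simp add: P_def divide_simps) (simp add: algebra_simps)
    have "(1 - s) / (1 + s) * ((1 - s * s) * w / P) = ((1 - s) * (1 - s * s) * w) / ((1 + s) * P)"
      by simp
    also have "(1 - s) * (1 - s * s) * w = (1 + s) * ((1 - s)\<^sup>2 * w)"
      by (simp add: algebra_simps power2_eq_square)
    finally have e2: "(1 - s) / (1 + s) * ((1 - s * s) * w / P) - 1 = ((1 - s)\<^sup>2 * w - P) / P"
      using P s1 by (simp add: diff_divide_distrib)
    have e3: "(1 - s)\<^sup>2 * w - P = - (2 * s * w) * (1 - of_real (cos t))"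
      using nw by (simp add: cos P_def field_simps power2_eq_square)
    show ?thesis
      unfolding d e1 e2 e3 using P s nw by (simp add: field_simps)
  qed
  ultimately have "(MP_primitive s has_field_derivative
     (1 - of_real (cos t)) / (of_real pi * (2 + 2 * of_real (cos t) - z))) (at (complex_of_real t))"
    by simp
  then show ?thesis by (rule has_vector_derivative_real_field)
qed

text \<open>Inverts the substitution \<open>x = 2 + 2 cos \<tau>\<close>. The derivative blows up at
  0 and 4, so the integrals below use continuity up to the ends and differentiability only
  inside.\<close>

lemma arccos_half_deriv:
  assumes x: "0 < x" "x < 4"
  shows "((\<lambda>x. arccos (x / 2 - 1)) has_vector_derivative - (1 / sqrt (x * (4 - x)))) (at x)"
proof -
  have "sqrt (1 - (x / 2 - 1)\<^sup>2) = sqrt (x * (4 - x) / 4)"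
    by (rule arg_cong[of _ _ sqrt]) (simp add: field_simps power2_eq_square)
  also have "\<dots> = sqrt (x * (4 - x)) / 2" by (simp add: real_sqrt_divide)
  finally have "sqrt (1 - (x / 2 - 1)\<^sup>2) = sqrt (x * (4 - x)) / 2" .
  then have "((\<lambda>x. arccos (x / 2 - 1)) has_real_derivative - (1 / sqrt (x * (4 - x)))) (at x)"
    using x by (auto intro!: derivative_eq_intros simp: inverse_eq_divide)
  then show ?thesis by (simp add: has_real_derivative_iff_has_vector_derivative)
qed

section \<open>Total mass of the Marchenko-Pastur density\<close>

lemma rho_MP_nonneg: "0 \<le> rho_MP x"
  by (cases "x = 0") (auto simp: rho_MP_def indicator_def)

lemma rho_MP_measurable [measurable]: "rho_MP \<in> borel_measurable borel"
  unfolding rho_MP_def by measurable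

text \<open>The first factor is the Jacobian of \<open>x = 2 + 2 cos \<tau>\<close>, the second is
  \<open>(1 - cos \<tau>) / \<pi>\<close>.\<close>

lemma rho_MP_inner:
  assumes "0 < x" "x < 4"
  shows "rho_MP x = (1 / sqrt (x * (4 - x))) * ((4 - x) / (2 * pi))"
proof -
  have "sqrt (x * (4 - x)) * sqrt (x * (4 - x)) = x * (4 - x)" "sqrt (x * (4 - x)) \<noteq> 0"
    using assms by auto
  then show ?thesis using assms by (simp add: rho_MP_def field_simps)
qed

lemma continuous_on_arccos_half: "continuous_on {0..4} (\<lambda>x. arccos (x / 2 - 1))"
  by (intro continuous_intros) auto

lemma has_integral_rho_MP: "(rho_MP has_integral 1) {0..4}"
proof -
  \<comment> \<open>An antiderivative of \<open>(1 - cos \<tau>) / \<pi>\<close> in the variable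
    \<tau>; the minus sign appears because \<tau> decreases from \<pi> to 0 as \<open>x\<close> runs
    from 0 to 4.\<close>
  let ?F = "\<lambda>x. - ((arccos (x / 2 - 1) - sin (arccos (x / 2 - 1))) / pi)"
  have "(rho_MP has_integral (?F 4 - ?F 0)) {0..4}"
  proof (rule fundamental_theorem_of_calculus_interior)
    show "continuous_on {0..4} ?F"
      by (intro continuous_intros continuous_on_arccos_half) auto
    fix x :: real assume x: "x \<in> {0<..<4}"
    have "((\<lambda>t. - ((t - sin t) / pi)) has_vector_derivative - ((1 - (x / 2 - 1)) / pi)) (at (arccos (x / 2 - 1)))"
      unfolding has_real_derivative_iff_has_vector_derivative[symmetric]
      using x by (auto intro!: derivative_eq_intros simp: cos_arccos)
    from vector_diff_chain_at[OF arccos_half_deriv this] x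
    show "(?F has_vector_derivative rho_MP x) (at x)"
      by (simp add: o_def rho_MP_inner field_simps)
  qed simp
  then show ?thesis by simp
qed

lemma has_integral_rho_MP_UNIV: "(rho_MP has_integral 1) UNIV"
  by (rule has_integral_on_superset[OF has_integral_rho_MP]) (auto simp: rho_MP_def)

lemma
  shows integrable_rho_MP: "integrable lborel rho_MP"
    and integral_rho_MP: "(LINT x|lborel. rho_MP x) = 1"
proof -
  have "(\<integral>\<^sup>+x. ennreal (rho_MP x) \<partial>lborel) = ennreal 1"
    using nn_integral_has_integral_lborel[OF _ rho_MP_nonneg has_integral_rho_MP_UNIV] by simp
  then have "has_bochner_integral lborel rho_MP 1"
    by (intro has_bochner_integral_nn_integral) (auto simp: rho_MP_nonneg)
  then show "integrable lborel rho_MP" "(LINT x|lborel. rho_MP x) = 1"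
    by (auto simp: has_bochner_integral_iff)
qed

section \<open>Closed form, quadratic equation and bounds for \<open>m_MP\<close>\<close>

lemma cmod_of_real_minus_ge: "Im z \<le> cmod (complex_of_real x - z)"
  using abs_Im_le_cmod[of "complex_of_real x - z"] by simp

lemma cmod_inverse_of_real_minus_le:
  assumes "Im z > 0" shows "cmod (1 / (complex_of_real x - z)) \<le> 1 / Im z"
  using assms cmod_of_real_minus_ge[of z x] by (simp add: norm_divide frac_le)

lemma integrable_m_MP:
  assumes z: "Im z > 0"
  shows "integrable lborel (\<lambda>x. 1 / (complex_of_real x - z) * complex_of_real (rho_MP x))"
proof (rule Bochner_Integration.integrable_bound)
  show "integrable lborel (\<lambda>x. rho_MP x / Im z)" using integrable_rho_MP by simp
  show "AE x in lborel. norm (1 / (complex_of_real x - z) * complex_of_real (rho_MP x)) \<le> norm (rho_MP x / Im z)"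
  proof (rule AE_I2)
    fix x
    have "cmod (1 / (complex_of_real x - z)) * \<bar>rho_MP x\<bar> \<le> 1 / Im z * \<bar>rho_MP x\<bar>"
      by (intro mult_right_mono cmod_inverse_of_real_minus_le z) auto
    then show "norm (1 / (complex_of_real x - z) * complex_of_real (rho_MP x)) \<le> norm (rho_MP x / Im z)"
      using z by (simp add: norm_mult norm_divide)
  qed
qed measurable

lemma m_MP_eq:
  assumes s: "s \<noteq> 0" "cmod s < 1" and z: "z = 2 + s + 1 / s" and im: "Im z > 0"
  shows "m_MP z = - s / (1 + s)"
proof -
  have s1: "1 + s \<noteq> 0" using s by (metis add_eq_0_iff norm_minus_cancel norm_one less_irrefl)
  let ?H = "\<lambda>t. MP_primitive s (complex_of_real t)"
  let ?F = "\<lambda>x. - ?H (arccos (x / 2 - 1))"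
  let ?f = "\<lambda>x. 1 / (complex_of_real x - z) * complex_of_real (rho_MP x)"
  note dH = MP_primitive_deriv[OF s z]
  have cH: "continuous_on UNIV ?H"
    using dH by (meson continuous_at_imp_continuous_on has_vector_derivative_continuous)
  have "(?f has_integral (?F 4 - ?F 0)) {0..4}"
  proof (rule fundamental_theorem_of_calculus_interior)
    show "continuous_on {0..4} ?F"
      using continuous_on_compose2[OF cH continuous_on_arccos_half] by (auto intro: continuous_on_minus)
    fix x :: real assume x: "x \<in> {0<..<4}"
    let ?D = "(1 - of_real (x / 2 - 1)) / (of_real pi * (of_real x - z))"
    have "(?H has_vector_derivative ?D) (at (arccos (x / 2 - 1)))"
      using dH[of "arccos (x / 2 - 1)"] x by (simp add: cos_arccos)
    from vector_diff_chain_at[OF arccos_half_deriv this] x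
    have "((\<lambda>x. ?H (arccos (x / 2 - 1))) has_vector_derivative (- (1 / sqrt (x * (4 - x)))) *\<^sub>R ?D) (at x)"
      by (simp add: o_def)
    then have "(?F has_vector_derivative - ((- (1 / sqrt (x * (4 - x)))) *\<^sub>R ?D)) (at x)"
      by (rule has_vector_derivative_minus)
    moreover have "?D = 1 / (of_real x - z) * of_real ((4 - x) / (2 * pi))"
      by (simp add: field_simps)
    then have "- ((- (1 / sqrt (x * (4 - x)))) *\<^sub>R ?D) = ?f x"
      using x by (simp only: rho_MP_inner greaterThanLessThan_iff of_real_mult) (simp add: scaleR_conv_of_real mult_ac)
    ultimately show "(?F has_vector_derivative ?f x) (at x)" by simp
  qed simp
  then have "(?f has_integral (?F 4 - ?F 0)) UNIV"
    by (rule has_integral_on_superset) (auto simp: rho_MP_def)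
  moreover have "(?f has_integral m_MP z) UNIV"
    unfolding m_MP_def by (rule has_integral_integral_lborel[OF integrable_m_MP[OF im]])
  ultimately have "m_MP z = ?F 4 - ?F 0" by (rule has_integral_unique[symmetric])
  also have "\<dots> = ?H pi - ?H 0" by simp
  \<comment> \<open>At \<tau> = 0 and at \<tau> = \<pi> the numbers \<open>exp (\<i> \<tau>)\<close>
    and \<open>exp (- \<i> \<tau>)\<close> coincide, so the logarithms cancel and only the linear
    terms remain.\<close>
  also have "\<dots> = ((1 - s) / (1 + s) * of_real pi - of_real pi) / (2 * of_real pi)"
    by (simp add: MP_primitive_def exp_minus)
  also have "\<dots> = - s / (1 + s)" using s1 by (simp add: divide_simps) (simp add: algebra_simps)
  finally show ?thesis .
qed

text \<open>With \<open>z = (1 + s)\<^sup>2 / s\<close> and \<open>m = - s / (1 + s)\<close> the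
  first two terms are \<open>s\<close> and \<open>- (1 + s)\<close>.\<close>

lemma m_MP_quadratic:
  assumes im: "Im z > 0"
  shows "z * (m_MP z)\<^sup>2 + z * m_MP z + 1 = 0"
proof -
  obtain s where s: "s \<noteq> 0" "cmod s < 1" and z: "z = 2 + s + 1 / s"
    using joukowski_root[OF im] by metis
  have s1: "1 + s \<noteq> 0" using s by (metis add_eq_0_iff norm_minus_cancel norm_one less_irrefl)
  have z': "z = (1 + s)\<^sup>2 / s" using s by (simp add: z field_simps power2_eq_square)
  show ?thesis
    unfolding m_MP_eq[OF s z im] unfolding z' using s s1
    by (simp add: divide_simps power2_eq_square)
qed

lemma m_MP_Im_nonneg:
  assumes z: "Im z > 0" shows "0 \<le> Im (m_MP z)"
proof -
  have "Im (m_MP z) = (LINT x|lborel. Im (1 / (complex_of_real x - z) * complex_of_real (rho_MP x)))"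
    unfolding m_MP_def by (rule integral_Im[OF integrable_m_MP[OF z], symmetric])
  also have "\<dots> \<ge> 0"
    using z rho_MP_nonneg by (intro Bochner_Integration.integral_nonneg) (auto simp: Im_divide intro!: divide_nonneg_nonneg)
  finally show ?thesis .
qed

lemma m_MP_Lipschitz:
  assumes z: "Im z > 0" and z': "Im z' > 0"
  shows "cmod (m_MP z - m_MP z') \<le> cmod (z - z') / (Im z * Im z')"
proof -
  let ?f = "\<lambda>z x. 1 / (complex_of_real x - z) * complex_of_real (rho_MP x)"
  have "m_MP z - m_MP z' = (LINT x|lborel. ?f z x - ?f z' x)"
    unfolding m_MP_def
    by (rule Bochner_Integration.integral_diff[OF integrable_m_MP[OF z] integrable_m_MP[OF z'], symmetric])
  also have "cmod \<dots> \<le> (LINT x|lborel. cmod (z - z') / (Im z * Im z') * rho_MP x)"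
  proof (rule Bochner_Integration.integral_norm_bound_integral)
    show "integrable lborel (\<lambda>x. ?f z x - ?f z' x)"
      by (intro Bochner_Integration.integrable_diff integrable_m_MP z z')
    show "integrable lborel (\<lambda>x. cmod (z - z') / (Im z * Im z') * rho_MP x)"
      using integrable_rho_MP by simp
    fix x
    have "complex_of_real x - z \<noteq> 0" "complex_of_real x - z' \<noteq> 0"
      using z z' by (auto simp: complex_eq_iff)
    then have "?f z x - ?f z' x = (z - z') * (1 / (complex_of_real x - z)) * (1 / (complex_of_real x - z')) * complex_of_real (rho_MP x)"
      by (simp add: field_simps)
    then have "cmod (?f z x - ?f z' x) = cmod (z - z') * (cmod (1 / (complex_of_real x - z)) * cmod (1 / (complex_of_real x - z'))) * rho_MP x"
      using rho_MP_nonneg[of x] by (simp only: norm_mult norm_of_real abs_of_nonneg mult.assoc)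
    also have "\<dots> \<le> cmod (z - z') * (1 / Im z * (1 / Im z')) * rho_MP x"
      using rho_MP_nonneg[of x] z z'
      by (intro mult_right_mono mult_left_mono mult_mono cmod_inverse_of_real_minus_le) auto
    finally show "norm (?f z x - ?f z' x) \<le> cmod (z - z') / (Im z * Im z') * rho_MP x" by simp
  qed
  also have "\<dots> = cmod (z - z') / (Im z * Im z')" by (simp add: integral_rho_MP)
  finally show ?thesis .
qed

text \<open>Completing the square, \<open>(m + 1/2)\<^sup>2 = 1/4 - 1/z\<close>; the real part of the right-hand side
  is negative and bounded away from \<open>0\<close> in the bulk.\<close>

lemma m_MP_Im_lower:
  assumes \<kappa>: "0 < \<kappa>" "\<kappa> < 1" and E: "\<kappa> \<le> Re z" "Re z \<le> 4 - \<kappa>" and \<eta>: "0 < Im z" "Im z \<le> \<kappa> / 2"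
  shows "sqrt (\<kappa> / 32) \<le> Im (m_MP z)"
proof -
  define m where "m = m_MP z"
  have z0: "z \<noteq> 0" using \<eta> by auto
  have "z * (m\<^sup>2 + m) = - 1"
    using m_MP_quadratic[OF \<eta>(1)] by (simp add: m_def distrib_left eq_neg_iff_add_eq_0)
  then have "m\<^sup>2 + m = - 1 / z" using z0 by (metis nonzero_mult_div_cancel_left)
  moreover have "(m + 1 / 2)\<^sup>2 = (m\<^sup>2 + m) + 1 / 4"
    by (simp add: power2_eq_square algebra_simps)
  ultimately have "(m + 1 / 2)\<^sup>2 = 1 / 4 - 1 / z" by simp
  then have "Re ((m + 1 / 2)\<^sup>2) = 1 / 4 - Re (1 / z)" by simp
  then have "(Re m + 1 / 2)\<^sup>2 - (Im m)\<^sup>2 = 1 / 4 - Re z / ((Re z)\<^sup>2 + (Im z)\<^sup>2)"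
    by (simp add: Re_divide power2_eq_square)
  then have b: "(Im m)\<^sup>2 \<ge> Re z / ((Re z)\<^sup>2 + (Im z)\<^sup>2) - 1 / 4"
    using zero_le_power2[of "Re m + 1 / 2"] by linarith
  have Ep: "0 < Re z" using \<kappa> E by simp
  \<comment> \<open>A height of at most \<kappa>/2 uses up only half of the distance to the edge 4:
    the squared modulus of \<open>z\<close> is at most \<open>(4 - \<kappa> / 2) * Re z\<close>, so
    the real part of \<open>1 / z\<close> still exceeds 1/4 by \<kappa>/32.\<close>
  have "(Im z)\<^sup>2 \<le> (\<kappa> / 2)\<^sup>2" using \<eta> by (intro power_mono) auto
  also have "\<dots> \<le> \<kappa> / 2 * Re z" using E \<kappa> by (simp add: power2_eq_square)
  finally have "(Re z)\<^sup>2 + (Im z)\<^sup>2 \<le> Re z * (Re z + \<kappa> / 2)" by (simp add: power2_eq_square algebra_simps)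
  also have "\<dots> \<le> Re z * (4 - \<kappa> / 2)" using E Ep by (intro mult_left_mono) auto
  finally have le: "(Re z)\<^sup>2 + (Im z)\<^sup>2 \<le> Re z * (4 - \<kappa> / 2)" .
  have "1 / (4 - \<kappa> / 2) = Re z / (Re z * (4 - \<kappa> / 2))" using Ep by simp
  also have "\<dots> \<le> Re z / ((Re z)\<^sup>2 + (Im z)\<^sup>2)"
    using Ep le \<eta> \<kappa> by (intro divide_left_mono) (auto simp: sum_power2_gt_zero_iff intro!: mult_pos_pos)
  finally have "1 / (4 - \<kappa> / 2) - 1 / 4 \<le> (Im m)\<^sup>2" using b by linarith
  moreover have "\<kappa> / 32 \<le> 1 / (4 - \<kappa> / 2) - 1 / 4"
  proof -
    have "1 / (4 - \<kappa> / 2) - 1 / 4 = (\<kappa> / 8) / (4 - \<kappa> / 2)" using \<kappa> by (simp add: field_simps)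
    also have "\<dots> \<ge> (\<kappa> / 8) / 4" using \<kappa> by (intro divide_left_mono) auto
    finally show ?thesis by simp
  qed
  ultimately have "\<kappa> / 32 \<le> (Im m)\<^sup>2" by linarith
  then have "sqrt (\<kappa> / 32) \<le> sqrt ((Im m)\<^sup>2)" by (rule real_sqrt_le_mono)
  then show ?thesis using m_MP_Im_nonneg[OF \<eta>(1)] by (simp add: m_def)
qed

subsection \<open>Mean squares of trigonometric polynomials\<close>

text \<open>For nonzero \<open>n\<close> the antiderivative takes the same value at both ends of the
  period.\<close>

lemma has_bochner_integral_cis:
  fixes n :: int
  shows "has_bochner_integral lborel (\<lambda>u. indicator {0..1} u *\<^sub>R cis (2 * pi * (of_int n * u)))
    (if n = 0 then 1 else 0)"
proof (cases "n = 0")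
  case True
  have "has_bochner_integral lborel (\<lambda>u::real. indicator {0..1} u *\<^sub>R (1::complex)) (measure lborel {0..1::real} *\<^sub>R 1)"
    by (intro has_bochner_integral_scaleR_left has_bochner_integral_real_indicator) auto
  then show ?thesis using True by simp
next
  case False
  let ?F = "\<lambda>u. cis (2 * pi * (of_int n * u)) / (2 * of_real pi * of_int n * \<i>)"
  have "has_bochner_integral lborel (\<lambda>u. indicator {0..1} u *\<^sub>R cis (2 * pi * (of_int n * u))) (?F 1 - ?F 0)"
  proof (rule has_bochner_integral_FTC_Icc)
    fix u :: real
    have "((\<lambda>\<tau>. exp (\<i> * (2 * of_real pi * (of_int n * \<tau>))) / (2 * of_real pi * of_int n * \<i>)) has_field_derivative
        exp (\<i> * (2 * of_real pi * (of_int n * of_real u)))) (at (of_real u))"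
      using False by (auto intro!: derivative_eq_intros)
    from has_vector_derivative_real_field[OF this, of "{0..1}"]
    show "(?F has_vector_derivative cis (2 * pi * (of_int n * u))) (at u within {0..1})"
      by (simp add: cis_conv_exp)
  qed (auto intro!: continuous_intros)
  moreover have "cis (2 * pi * of_int n) = 1"
    by (simp add: cis_multiple_2pi)
  ultimately show ?thesis using False by simp
qed

lemma has_bochner_integral_trig_poly:
  fixes \<alpha> :: "'p \<Rightarrow> complex" and n :: "'p \<Rightarrow> int"
  assumes "finite P"
  shows "has_bochner_integral lborel
    (\<lambda>u. indicator {0..1} u *\<^sub>R (\<Sum>p\<in>P. \<alpha> p * cis (2 * pi * (of_int (n p) * u)))) (\<Sum>p\<in>{p\<in>P. n p = 0}. \<alpha> p)"
proof -
  have "has_bochner_integral lborel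
    (\<lambda>u. \<Sum>p\<in>P. \<alpha> p * (indicator {0..1} u *\<^sub>R cis (2 * pi * (of_int (n p) * u)))) (\<Sum>p\<in>P. \<alpha> p * (if n p = 0 then 1 else 0))"
    by (intro has_bochner_integral_sum has_bochner_integral_mult_right has_bochner_integral_cis)
  moreover have "(\<Sum>p\<in>P. \<alpha> p * (if n p = 0 then 1 else 0)) = (\<Sum>p\<in>{p\<in>P. n p = 0}. \<alpha> p)"
    using assms by (intro sum.mono_neutral_cong_right) auto
  ultimately show ?thesis
    by (simp add: scaleR_sum_right)
qed

text \<open>The mean of a trigonometric polynomial is the sum of its coefficients of frequency 0.
  Reality and positivity of this sum are recorded because it serves again as a non-negative
  integrand in the second variable.\<close>

lemma
  fixes \<alpha> :: "'p \<Rightarrow> complex" and n :: "'p \<Rightarrow> int" and g :: "real \<Rightarrow> real"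
  assumes P: "finite P" and nonneg: "\<And>u. 0 \<le> g u"
    and g: "\<And>u. complex_of_real (g u) = (\<Sum>p\<in>P. \<alpha> p * cis (2 * pi * (of_int (n p) * u)))"
  defines "S \<equiv> \<Sum>p\<in>{p\<in>P. n p = 0}. \<alpha> p"
  shows trig_poly_mean_real: "complex_of_real (Re S) = S"
    and trig_poly_mean_nonneg: "0 \<le> Re S"
    and nn_integral_trig_poly: "(\<integral>\<^sup>+u. ennreal (g u) * indicator {0..1} u \<partial>lborel) = ennreal (Re S)"
proof -
  have S: "has_bochner_integral lborel (\<lambda>u. complex_of_real (indicator {0..1} u * g u)) S"
    using has_bochner_integral_trig_poly[OF P, of \<alpha> n] unfolding S_def g[symmetric]
    by (simp add: scaleR_conv_of_real)
  have re: "has_bochner_integral lborel (\<lambda>u. indicator {0..1} u * g u) (Re S)"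
    using has_bochner_integral_bounded_linear[OF bounded_linear_Re S] by simp
  have "has_bochner_integral lborel (\<lambda>u. complex_of_real (indicator {0..1} u * g u)) (complex_of_real (Re S))"
    by (rule has_bochner_integral_of_real[OF re])
  then show "complex_of_real (Re S) = S"
    using S has_bochner_integral_eq by blast
  have int: "integrable lborel (\<lambda>u. indicator {0..1} u * g u)" "(LINT u|lborel. indicator {0..1} u * g u) = Re S"
    using re by (auto simp: has_bochner_integral_iff)
  then show "0 \<le> Re S"
    using nonneg by (metis (no_types, lifting) Bochner_Integration.integral_nonneg indicator_pos_le mult_nonneg_nonneg)
  have "(\<integral>\<^sup>+u. ennreal (indicator {0..1} u * g u) \<partial>lborel) = ennreal (Re S)"
    using nonneg int by (subst nn_integral_eq_integral) auto
  then show "(\<integral>\<^sup>+u. ennreal (g u) * indicator {0..1} u \<partial>lborel) = ennreal (Re S)"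
    by (simp add: nonneg ennreal_mult'' ennreal_indicator mult.commute)
qed

text \<open>The squared modulus is a sum over pairs of indices. Integration in \<open>u\<close>
  keeps the pairs with equal \<open>f\<close>, integration in \<open>v\<close> those with equal
  \<open>g\<close> as well, and injectivity leaves the diagonal. The comparison with Lebesgue
  measure is used once per variable, whence \<open>B\<^sup>2\<close>.\<close>

lemma nn_integral_trig_poly_sq:
  fixes a :: "'p \<Rightarrow> complex" and f g :: "'p \<Rightarrow> int" and \<mu> :: "real measure"
  assumes I: "finite I" and inj: "inj_on (\<lambda>i. (f i, g i)) I"
    and B: "\<And>h. h \<in> borel_measurable borel \<Longrightarrow>
      (\<integral>\<^sup>+u. h u \<partial>\<mu>) \<le> ennreal B * (\<integral>\<^sup>+u. h u * indicator {0..1} u \<partial>lborel)" and B0: "B \<ge> 0"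
  shows "(\<integral>\<^sup>+v. (\<integral>\<^sup>+u. ennreal ((cmod (\<Sum>i\<in>I. a i * cis (2 * pi * (of_int (f i) * u + of_int (g i) * v))))\<^sup>2) \<partial>\<mu>) \<partial>\<mu>)
    \<le> ennreal (B\<^sup>2 * (\<Sum>i\<in>I. (cmod (a i))\<^sup>2))"
proof -
  define Q where "Q u v = (\<Sum>i\<in>I. a i * cis (2 * pi * (of_int (f i) * u + of_int (g i) * v)))" for u v
  define \<alpha> where "\<alpha> p = a (fst p) * cnj (a (snd p))" for p
  define F G where "F p = f (fst p) - f (snd p)" and "G p = g (fst p) - g (snd p)" for p
  define e where "e p v = cis (2 * pi * (of_int (G p) * v))" for p v
  define P where "P = {p \<in> I \<times> I. F p = 0}"
  define S where "S v = (\<Sum>p\<in>P. \<alpha> p * e p v)" for v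
  have fin: "finite (I \<times> I)" "finite P" using I by (auto simp: P_def)
  have Qsq: "complex_of_real ((cmod (Q u v))\<^sup>2) =
      (\<Sum>p\<in>I\<times>I. (\<alpha> p * e p v) * cis (2 * pi * (of_int (F p) * u)))" for u v
  proof -
    have "complex_of_real ((cmod (Q u v))\<^sup>2) = Q u v * cnj (Q u v)" by (rule complex_norm_square)
    also have "\<dots> = (\<Sum>p\<in>I\<times>I. (a (fst p) * cis (2 * pi * (of_int (f (fst p)) * u + of_int (g (fst p)) * v))) *
        cnj (a (snd p) * cis (2 * pi * (of_int (f (snd p)) * u + of_int (g (snd p)) * v))))"
      unfolding Q_def cnj_sum sum_product by (simp add: sum.cartesian_product case_prod_unfold)
    also have "\<dots> = (\<Sum>p\<in>I\<times>I. (\<alpha> p * e p v) * cis (2 * pi * (of_int (F p) * u)))"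
      by (intro sum.cong refl) (simp add: \<alpha>_def e_def F_def G_def cis_cnj cis_mult mult_ac algebra_simps)
    finally show ?thesis .
  qed
  note inner = trig_poly_mean_real[OF fin(1) zero_le_power2 Qsq] trig_poly_mean_nonneg[OF fin(1) zero_le_power2 Qsq]
    nn_integral_trig_poly[OF fin(1) zero_le_power2 Qsq]
  have inner1: "complex_of_real (Re (S v)) = (\<Sum>p\<in>P. \<alpha> p * cis (2 * pi * (of_int (G p) * v)))" for v
    using inner(1)[of v] by (simp add: S_def P_def e_def)
  have inner2: "0 \<le> Re (S v)" for v using inner(2)[of v] by (simp add: S_def P_def)
  have inner3: "(\<integral>\<^sup>+u. ennreal ((cmod (Q u v))\<^sup>2) * indicator {0..1} u \<partial>lborel) = ennreal (Re (S v))" for v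
    using inner(3)[of v] by (simp add: S_def P_def)
  have [measurable]: "(\<lambda>u. Q u v) \<in> borel_measurable borel" for v
    unfolding Q_def by (intro borel_measurable_continuous_onI continuous_intros)
  have [measurable]: "(\<lambda>v. Re (S v)) \<in> borel_measurable borel"
    unfolding S_def e_def by (intro borel_measurable_continuous_onI continuous_intros)
  \<comment> \<open>Comparison first for fixed \<open>v\<close>. The resulting mean
    \<open>Re (S v)\<close> is a non-negative trigonometric polynomial in \<open>v\<close>, so the
    same two steps apply to it.\<close>
  have "(\<integral>\<^sup>+v. (\<integral>\<^sup>+u. ennreal ((cmod (Q u v))\<^sup>2) \<partial>\<mu>) \<partial>\<mu>) \<le> (\<integral>\<^sup>+v. ennreal B * ennreal (Re (S v)) \<partial>\<mu>)"
    unfolding inner3[symmetric] by (intro nn_integral_mono B) measurable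
  also have "\<dots> \<le> ennreal B * (\<integral>\<^sup>+v. (ennreal B * ennreal (Re (S v))) * indicator {0..1} v \<partial>lborel)"
    by (rule B) measurable
  also have "\<dots> = ennreal B * (ennreal B * (\<integral>\<^sup>+v. ennreal (Re (S v)) * indicator {0..1} v \<partial>lborel))"
    by (simp add: nn_integral_cmult mult.assoc)
  also have "(\<integral>\<^sup>+v. ennreal (Re (S v)) * indicator {0..1} v \<partial>lborel) = ennreal (Re (\<Sum>p\<in>{p\<in>P. G p = 0}. \<alpha> p))"
    by (rule nn_integral_trig_poly[OF fin(2) inner2 inner1])
  also have "(\<Sum>p\<in>{p\<in>P. G p = 0}. \<alpha> p) = complex_of_real (\<Sum>i\<in>I. (cmod (a i))\<^sup>2)"
  proof -
    have "{p\<in>P. G p = 0} = (\<lambda>i. (i, i)) ` I"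
    proof (intro equalityI subsetI)
      fix p assume "p \<in> {p\<in>P. G p = 0}"
      then have "fst p \<in> I" "snd p \<in> I" "(f (fst p), g (fst p)) = (f (snd p), g (snd p))"
        by (auto simp: P_def F_def G_def)
      then have "fst p = snd p" using inj_onD[OF inj] by blast
      then show "p \<in> (\<lambda>i. (i, i)) ` I" using \<open>fst p \<in> I\<close> by (cases p) auto
    qed (auto simp: P_def F_def G_def)
    then have "(\<Sum>p\<in>{p\<in>P. G p = 0}. \<alpha> p) = (\<Sum>i\<in>I. a i * cnj (a i))"
      by (simp add: sum.reindex inj_on_def \<alpha>_def)
    then show ?thesis unfolding of_real_sum complex_norm_square .
  qed
  also have "ennreal B * (ennreal B * ennreal (Re (complex_of_real (\<Sum>i\<in>I. (cmod (a i))\<^sup>2)))) =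
      ennreal (B\<^sup>2 * (\<Sum>i\<in>I. (cmod (a i))\<^sup>2))"
    using B0 by (simp add: ennreal_mult' power2_eq_square mult.assoc sum_nonneg)
  finally show ?thesis unfolding Q_def .
qed

subsection \<open>Second moments of the quadratic forms\<close>

lemma borel_measurable_det:
  fixes A :: "'b \<Rightarrow> complex mat"
  assumes A: "\<And>x. A x \<in> carrier_mat n n"
    and m: "\<And>i k. i < n \<Longrightarrow> k < n \<Longrightarrow> (\<lambda>x. A x $$ (i, k)) \<in> borel_measurable M"
  shows "(\<lambda>x. Determinant.det (A x)) \<in> borel_measurable M"
proof -
  have "(\<lambda>x. signof p * (\<Prod>i = 0..<n. A x $$ (i, p i))) \<in> borel_measurable M"
    if "p permutes {0..<n}" for p
  proof (intro borel_measurable_times borel_measurable_const borel_measurable_prod m)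
    fix i assume i: "i \<in> {0..<n}"
    then show "i < n" by simp
    have "p i \<in> {0..<n}" using i permutes_in_image[OF that] by blast
    then show "p i < n" by simp
  qed
  then show ?thesis
    unfolding det_def'[OF A] by (intro borel_measurable_sum) auto
qed

text \<open>By Cramer's rule an entry is a cofactor times the inverse of a determinant. As
  \<open>inverse 0 = 0\<close>, inversion is Borel on the whole plane and singular matrices need no
  separate case.\<close>

lemma borel_measurable_resolvent:
  fixes A :: "'b \<Rightarrow> complex mat"
  assumes A: "\<And>x. A x \<in> carrier_mat n n"
    and m: "\<And>i k. i < n \<Longrightarrow> k < n \<Longrightarrow> (\<lambda>x. A x $$ (i, k)) \<in> borel_measurable M"
    and ij: "i < n" "j < n"
  shows "(\<lambda>x. resolvent (A x) z $$ (i, j)) \<in> borel_measurable M"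
proof -
  define B where "B x = A x - z \<cdot>\<^sub>m 1\<^sub>m n" for x
  have B: "B x \<in> carrier_mat n n" for x by (auto simp: B_def)
  have mB: "(\<lambda>x. B x $$ (i, k)) \<in> borel_measurable M" if "i < n" "k < n" for i k
    using m[OF that] that by (simp add: B_def)
  have eq: "resolvent (A x) z $$ (i, j) = inverse (Determinant.det (B x)) *
      ((- 1) ^ (j + i) * Determinant.det (mat_delete (B x) j i))" for x
  proof -
    have "dim_row (A x) = n" using A by blast
    then show ?thesis
      using ij B[of x] by (simp add: resolvent_def Let_def B_def adj_mat_def cofactor_def)
  qed
  have "(\<lambda>x. Determinant.det (mat_delete (B x) j i)) \<in> borel_measurable M"
  proof (rule borel_measurable_det[of _ "n - 1"])
    show "mat_delete (B x) j i \<in> carrier_mat (n - 1) (n - 1)" for x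
      using B[of x] by (rule mat_delete_carrier)
    fix i' k' assume *: "i' < n - 1" "k' < n - 1"
    have "mat_delete (B x) j i $$ (i', k') = B x $$ (insert_index j i', insert_index i k')" for x
      using * ij B[of x] mat_delete_index[of "B x" "n - 1" j i i' k'] by simp
    moreover have "insert_index j i' < n" "insert_index i k' < n"
      using * by (auto simp: insert_index_def)
    ultimately show "(\<lambda>x. mat_delete (B x) j i $$ (i', k')) \<in> borel_measurable M"
      using mB by simp
  qed
  moreover have "(\<lambda>x. Determinant.det (B x)) \<in> borel_measurable M"
    by (rule borel_measurable_det[OF B mB])
  ultimately show ?thesis unfolding eq by measurable
qed

lemma row_form_sum:
  assumes X: "X \<in> carrier_mat n n"
  shows "row_form X z j = (\<Sum>k<n. \<Sum>l<n. resolvent (gram (zero_row X j)) z $$ (k, l) * cnj (X $$ (j, l)) * X $$ (j, k))"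
proof -
  have R: "resolvent (gram (zero_row X j)) z \<in> carrier_mat n n" using X by simp
  note [simp] = carrier_matD[OF X] carrier_matD[OF R]
  show ?thesis
    unfolding row_form_def inner_sum
    by (auto simp: scalar_prod_def crow_def lessThan_atLeast0 sum_distrib_right intro!: sum.cong)
qed

lemma borel_measurable_row_dev:
  fixes X :: "'b \<Rightarrow> complex mat"
  assumes X: "\<And>x. X x \<in> carrier_mat n n" and j: "j < n"
    and m: "\<And>i k. i < n \<Longrightarrow> k < n \<Longrightarrow> (\<lambda>x. X x $$ (i, k)) \<in> borel_measurable M"
  shows "(\<lambda>x. row_dev (X x) z j) \<in> borel_measurable M"
proof -
  have dim: "dim_row (X x) = n" "dim_col (X x) = n" for x using X by auto
  have mz: "(\<lambda>x. zero_row (X x) j $$ (i, k)) \<in> borel_measurable M" if "i < n" "k < n" for i k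
    using m[OF that] that by (simp add: zero_row_def dim)
  have mg: "(\<lambda>x. gram (zero_row (X x) j) $$ (k, l)) \<in> borel_measurable M" if "k < n" "l < n" for k l
    unfolding gram_index[OF zero_row_carrier[OF X] that]
    using that by (intro borel_measurable_sum borel_measurable_times mz
        borel_measurable_continuous_on[OF continuous_on_cnj[OF continuous_on_id], unfolded id_def] ) auto
  have mr: "(\<lambda>x. resolvent (gram (zero_row (X x) j)) z $$ (k, l)) \<in> borel_measurable M"
    if "k < n" "l < n" for k l
    using X by (intro borel_measurable_resolvent[OF _ mg that]) auto
  have mc: "(\<lambda>x. cnj (X x $$ (i, k))) \<in> borel_measurable M" if "i < n" "k < n" for i k
    using m[OF that] by (rule borel_measurable_continuous_on[OF continuous_on_cnj[OF continuous_on_id], unfolded id_def])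
  have tr: "mat_trace (resolvent (gram (zero_row (X x) j)) z) =
      (\<Sum>k<n. resolvent (gram (zero_row (X x) j)) z $$ (k, k))" for x
    using X by (intro mat_trace_sum) auto
  show ?thesis
    unfolding row_dev_def row_form_sum[OF X] dim tr
    by (intro borel_measurable_diff borel_measurable_divide borel_measurable_sum borel_measurable_times
        borel_measurable_const mr mc m j) auto
qed

lemma borel_measurable_X_mat:
  assumes "\<And>j q. j \<in> {1..N} \<Longrightarrow> q \<in> {1..d} \<Longrightarrow> (\<lambda>x. w x j q) \<in> borel_measurable M" "j < N" "k < N"
  shows "(\<lambda>x. X_mat N d (w x) $$ (j, k)) \<in> borel_measurable M"
proof -
  have "(\<lambda>x. \<Sum>q = 1..d. w x (j + 1) q * real (k + 1) ^ q) \<in> borel_measurable M"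
    using assms by (intro borel_measurable_sum borel_measurable_times) auto
  moreover have "cis \<in> borel_measurable borel"
    by (intro borel_measurable_continuous_onI continuous_intros)
  ultimately show ?thesis
    unfolding X_mat_index[OF assms(2,3)] by measurable
qed

text \<open>Allows the array to be replaced by its restriction to the finite index set of the
  product space.\<close>

lemma X_mat_cong:
  assumes "\<And>j q. j \<in> {1..N} \<Longrightarrow> q \<in> {1..d} \<Longrightarrow> w j q = w' j q"
  shows "X_mat N d w = X_mat N d w'"
proof (rule eq_matI)
  fix j k assume "j < dim_row (X_mat N d w')" "k < dim_col (X_mat N d w')"
  then have jk: "j < N" "k < N" by auto
  have "(\<Sum>q = 1..d. w (j + 1) q * real (k + 1) ^ q) = (\<Sum>q = 1..d. w' (j + 1) q * real (k + 1) ^ q)"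
    using assms jk by (intro sum.cong) auto
  then show "X_mat N d w $$ (j, k) = X_mat N d w' $$ (j, k)"
    by (simp only: X_mat_index[OF jk])
qed auto

section \<open>The deviation as a trigonometric polynomial in two variables\<close>

text \<open>Matrix row \<open>j\<close> is built from the variables with index \<open>j + 1\<close>,
  so \<open>R\<^sub>j\<close> stays fixed while these are integrated.\<close>

lemma zero_row_X_mat_upd:
  "zero_row (X_mat N d (w(j + 1 := f))) j = zero_row (X_mat N d w) j"
  by (rule eq_matI) (auto simp: zero_row_def X_mat_index)

text \<open>In \<open>x\<^sub>j R\<^sub>j x\<^sub>j\<^sup>*\<close> the diagonal terms have no phase
  and add up to \<open>tr R\<^sub>j / N\<close>, which is subtracted. In the other terms the powers
  \<open>q \<ge> 3\<close> only contribute a factor of modulus 1, while \<open>q = 1\<close> and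
  \<open>q = 2\<close> produce the frequencies.\<close>

lemma row_dev_X_mat:
  fixes w :: "nat \<Rightarrow> nat \<Rightarrow> real" and u v :: real and z :: complex
  assumes j: "j < N" and d: "2 \<le> d"
  defines "R \<equiv> resolvent (gram (zero_row (X_mat N d w) j)) z"
    and "r \<equiv> \<lambda>k. \<Sum>q = 3..d. w (j + 1) q * real (k + 1) ^ q"
  shows "row_dev (X_mat N d (w(j + 1 := (w (j + 1))(1 := u, 2 := v)))) z j =
    (\<Sum>p\<in>{p \<in> {..<N} \<times> {..<N}. fst p \<noteq> snd p}. R $$ p / of_nat N * cis (2 * pi * (r (fst p) - r (snd p))) *
      cis (2 * pi * (of_int (int (fst p) - int (snd p)) * u
        + of_int ((int (fst p) + 1)\<^sup>2 - (int (snd p) + 1)\<^sup>2) * v)))"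
proof -
  define X where "X = X_mat N d (w(j + 1 := (w (j + 1))(1 := u, 2 := v)))"
  define I where "I = {p \<in> {..<N} \<times> {..<N}. fst p \<noteq> snd p}"
  define D where "D = (\<lambda>k. (k, k)) ` {..<N}"
  define T where "T p = R $$ p * cnj (X $$ (j, snd p)) * X $$ (j, fst p)" for p
  have N: "N > 0" using j by simp
  have X: "X \<in> carrier_mat N N" by (simp add: X_def)
  have R: "R \<in> carrier_mat N N" by (simp add: R_def)
  have zr: "resolvent (gram (zero_row X j)) z = R"
    unfolding X_def R_def zero_row_X_mat_upd ..
  have ent: "X $$ (j, k) = of_real (1 / sqrt (real N)) *
      cis (2 * pi * (u * real (k + 1) + v * (real (k + 1))\<^sup>2 + r k))" if k: "k < N" for k
  proof -
    have "{1..d} = insert 1 (insert 2 {3..d})" using d by auto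
    then have "(\<Sum>q = 1..d. (w(j + 1 := (w (j + 1))(1 := u, 2 := v))) (j + 1) q * real (k + 1) ^ q)
        = u * real (k + 1) + v * (real (k + 1))\<^sup>2 + r k"
      by (simp add: r_def)
    then show ?thesis unfolding X_def X_mat_index[OF j k] by simp
  qed
  have prod: "cnj (X $$ (j, l)) * X $$ (j, k) = cis (2 * pi * (r k - r l)) *
      cis (2 * pi * (of_int (int k - int l) * u + of_int ((int k + 1)\<^sup>2 - (int l + 1)\<^sup>2) * v)) / of_nat N"
    if "k < N" "l < N" for k l
  proof -
    define c where "c = complex_of_real (1 / sqrt (real N))"
    define \<theta> where "\<theta> k = 2 * pi * (u * real (k + 1) + v * (real (k + 1))\<^sup>2 + r k)" for k
    have cc: "c * c = 1 / of_nat N" "cnj c = c"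
      unfolding c_def of_real_mult[symmetric] by simp_all
    have "cnj (X $$ (j, l)) * X $$ (j, k) = c * c * (cis (- \<theta> l) * cis (\<theta> k))"
      unfolding ent[OF that(1)] ent[OF that(2)] c_def[symmetric] \<theta>_def[symmetric]
      by (simp add: cis_cnj cc(2))
    moreover have "cis (- \<theta> l) * cis (\<theta> k) = cis (2 * pi * (r k - r l)) *
      cis (2 * pi * (of_int (int k - int l) * u + of_int ((int k + 1)\<^sup>2 - (int l + 1)\<^sup>2) * v))"
      unfolding cis_mult
      by (rule arg_cong[of _ _ cis]) (simp add: \<theta>_def algebra_simps power2_eq_square)
    ultimately show ?thesis by (simp add: cc(1))
  qed
  have split: "{..<N} \<times> {..<N} = I \<union> D" "I \<inter> D = {}" by (auto simp: I_def D_def)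
  have fin: "finite I" "finite D" by (auto simp: I_def D_def)
  have "row_form X z j = (\<Sum>p\<in>{..<N} \<times> {..<N}. T p)"
    unfolding row_form_sum[OF X] zr by (simp add: sum.cartesian_product T_def case_prod_unfold)
  also have "\<dots> = sum T I + sum T D"
    unfolding split(1) by (rule sum.union_disjoint[OF fin split(2)])
  also have "sum T D = (\<Sum>k<N. R $$ (k, k) / of_nat N)"
    unfolding D_def using prod by (subst sum.reindex) (auto simp: inj_on_def T_def mult.assoc)
  also have "\<dots> = mat_trace R / of_nat N"
    by (simp add: mat_trace_sum[OF R] sum_divide_distrib)
  finally have "row_dev X z j = sum T I"
    using X by (simp add: row_dev_def zr)
  also have "\<dots> = (\<Sum>p\<in>I. R $$ p / of_nat N * cis (2 * pi * (r (fst p) - r (snd p))) *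
      cis (2 * pi * (of_int (int (fst p) - int (snd p)) * u
        + of_int ((int (fst p) + 1)\<^sup>2 - (int (snd p) + 1)\<^sup>2) * v)))"
  proof (intro sum.cong refl)
    fix p assume "p \<in> I"
    then have "fst p < N" "snd p < N" by (auto simp: I_def)
    from prod[OF this] show "T p = R $$ p / of_nat N * cis (2 * pi * (r (fst p) - r (snd p))) *
      cis (2 * pi * (of_int (int (fst p) - int (snd p)) * u
        + of_int ((int (fst p) + 1)\<^sup>2 - (int (snd p) + 1)\<^sup>2) * v))"
      by (simp add: T_def mult.assoc)
  qed
  finally show ?thesis by (simp add: X_def I_def)
qed

text \<open>The second component is the nonzero first component times
  \<open>fst p + snd p + 2\<close>, so the sum is determined along with the difference. The
  differences alone would repeat along every diagonal.\<close>

lemma inj_on_difference_squares: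
  "inj_on (\<lambda>p. (int (fst p) - int (snd p), (int (fst p) + 1)\<^sup>2 - (int (snd p) + 1)\<^sup>2)) {p. fst p \<noteq> snd p}"
proof (rule inj_onI)
  fix p p' :: "nat \<times> nat"
  assume ne: "p \<in> {p. fst p \<noteq> snd p}" "p' \<in> {p. fst p \<noteq> snd p}"
    and eq: "(int (fst p) - int (snd p), (int (fst p) + 1)\<^sup>2 - (int (snd p) + 1)\<^sup>2) =
      (int (fst p') - int (snd p'), (int (fst p') + 1)\<^sup>2 - (int (snd p') + 1)\<^sup>2)"
  have fac: "(int (fst p) + 1)\<^sup>2 - (int (snd p) + 1)\<^sup>2 = (int (fst p) - int (snd p)) * (int (fst p) + int (snd p) + 2)"
    for p :: "nat \<times> nat" by (simp add: power2_eq_square algebra_simps)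
  have d: "int (fst p) - int (snd p) = int (fst p') - int (snd p')" using eq by simp
  have "(int (fst p) - int (snd p)) * (int (fst p) + int (snd p) + 2) =
      (int (fst p) - int (snd p)) * (int (fst p') + int (snd p') + 2)"
    using eq fac[of p] fac[of p'] d by simp
  then have "int (fst p) + int (snd p) = int (fst p') + int (snd p')"
    using ne(1) by simp
  with d have "fst p = fst p'" "snd p = snd p'" by linarith+
  then show "p = p'" by (rule prod_eqI)
qed

lemma nn_integral_row_dev:
  fixes w :: "nat \<Rightarrow> nat \<Rightarrow> real" and \<mu> :: "real measure"
  assumes j: "j < N" and d: "2 \<le> d" and z: "Im z > 0"
    and B: "\<And>h. h \<in> borel_measurable borel \<Longrightarrow>
      (\<integral>\<^sup>+u. h u \<partial>\<mu>) \<le> ennreal B * (\<integral>\<^sup>+u. h u * indicator {0..1} u \<partial>lborel)" and B0: "B \<ge> 0"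
  shows "(\<integral>\<^sup>+v. (\<integral>\<^sup>+u. ennreal ((cmod (row_dev (X_mat N d (w(j + 1 := (w (j + 1))(1 := u, 2 := v)))) z j))\<^sup>2) \<partial>\<mu>) \<partial>\<mu>)
    \<le> ennreal (B\<^sup>2 / (real N * (Im z)\<^sup>2))"
proof -
  define I where "I = {p \<in> {..<N} \<times> {..<N}. fst p \<noteq> snd p}"
  define R where "R = resolvent (gram (zero_row (X_mat N d w) j)) z"
  define r where "r k = (\<Sum>q = 3..d. w (j + 1) q * real (k + 1) ^ q)" for k
  define a where "a p = R $$ p / of_nat N * cis (2 * pi * (r (fst p) - r (snd p)))" for p
  have "(\<integral>\<^sup>+v. (\<integral>\<^sup>+u. ennreal ((cmod (row_dev (X_mat N d (w(j + 1 := (w (j + 1))(1 := u, 2 := v)))) z j))\<^sup>2) \<partial>\<mu>) \<partial>\<mu>)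
    \<le> ennreal (B\<^sup>2 * (\<Sum>p\<in>I. (cmod (a p))\<^sup>2))"
    unfolding row_dev_X_mat[OF j d] R_def[symmetric] r_def[symmetric] I_def[symmetric] a_def[symmetric]
    by (rule nn_integral_trig_poly_sq[OF _ _ B B0])
       (auto simp: I_def intro: inj_on_subset[OF inj_on_difference_squares])
  also have "\<dots> \<le> ennreal (B\<^sup>2 / (real N * (Im z)\<^sup>2))"
  proof (intro ennreal_leI)
    have "(\<Sum>p\<in>I. (cmod (a p))\<^sup>2) = (\<Sum>p\<in>I. (cmod (R $$ p))\<^sup>2) / (real N)\<^sup>2"
      by (simp add: a_def norm_mult norm_divide power_divide sum_divide_distrib)
    also have "(\<Sum>p\<in>I. (cmod (R $$ p))\<^sup>2) \<le> (\<Sum>p\<in>{..<N}\<times>{..<N}. (cmod (R $$ p))\<^sup>2)"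
      by (intro sum_mono2) (auto simp: I_def)
    also have "\<dots> = (\<Sum>k<N. \<Sum>l<N. (cmod (R $$ (k, l)))\<^sup>2)"
      by (simp add: sum.cartesian_product case_prod_unfold)
    also have "\<dots> = (\<Sum>l<N. \<Sum>k<N. (cmod (R $$ (k, l)))\<^sup>2)"
      by (rule sum.swap)
    also have "\<dots> \<le> real N / (Im z)\<^sup>2"
      unfolding R_def by (rule resolvent_Frobenius_le[OF zero_row_carrier[OF X_mat_carrier] z])
    finally have "(\<Sum>p\<in>I. (cmod (a p))\<^sup>2) \<le> (real N / (Im z)\<^sup>2) / (real N)\<^sup>2"
      by (simp add: divide_right_mono)
    also have "\<dots> = 1 / (real N * (Im z)\<^sup>2)"
      using j by (simp add: power2_eq_square)
    finally show "B\<^sup>2 * (\<Sum>p\<in>I. (cmod (a p))\<^sup>2) \<le> B\<^sup>2 / (real N * (Im z)\<^sup>2)"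
      using mult_left_mono[of _ _ "B\<^sup>2"] by fastforce
  qed
  finally show ?thesis .
qed


section \<open>The law of the array and the second moment of a deviation\<close>

lemma torus_density_bound:
  assumes "torus_density C \<rho>"
  obtains B where "B \<ge> 0" "\<And>x. x \<in> {0..1} \<Longrightarrow> \<rho> x \<le> B"
proof -
  have "continuous_on {0..1} \<rho>"
    using assms by (auto simp: torus_density_def intro!: continuous_at_imp_continuous_on differentiable_imp_continuous_within)
  then have "bounded (\<rho> ` {0..1})"
    by (intro compact_imp_bounded compact_continuous_image) auto
  then obtain B where "\<forall>y\<in>\<rho> ` {0..1}. norm y \<le> B"
    unfolding bounded_iff by blast
  then have B: "norm (\<rho> x) \<le> B" if "x \<in> {0..1}" for x using that by blast
  show ?thesis
  proof
    show "B \<ge> 0" using B[of 0] by (auto intro: order_trans[OF norm_ge_zero])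
    show "\<rho> x \<le> B" if "x \<in> {0..1}" for x using B[OF that] by simp
  qed
qed

lemma torus_density_measurable:
  assumes "torus_density C \<rho>" shows "\<rho> \<in> borel_measurable borel"
  using assms
  by (auto simp: torus_density_def intro!: borel_measurable_continuous_onI continuous_at_imp_continuous_on
      differentiable_imp_continuous_within)

definition torus_measure :: "(real \<Rightarrow> real) \<Rightarrow> real measure" where
  "torus_measure \<rho> = density lborel (\<lambda>x. ennreal (\<rho> x * indicator {0..<1} x))"

lemma sets_torus_measure [simp, measurable_cong]: "sets (torus_measure \<rho>) = sets borel"
  by (simp add: torus_measure_def)

text \<open>Supplies the comparison hypothesis of \<open>nn_integral_trig_poly_sq\<close>; passing
  from the half-open to the closed interval only enlarges the right-hand side.\<close>

lemma nn_integral_torus_measure_le: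
  assumes [measurable]: "\<rho> \<in> borel_measurable borel" "h \<in> borel_measurable borel"
    and B: "\<And>x. x \<in> {0..1} \<Longrightarrow> \<rho> x \<le> B"
  shows "(\<integral>\<^sup>+u. h u \<partial>torus_measure \<rho>) \<le> ennreal B * (\<integral>\<^sup>+u. h u * indicator {0..1} u \<partial>lborel)"
proof -
  have "(\<integral>\<^sup>+u. h u \<partial>torus_measure \<rho>) = (\<integral>\<^sup>+u. ennreal (\<rho> u * indicator {0..<1} u) * h u \<partial>lborel)"
    unfolding torus_measure_def by (subst nn_integral_density) auto
  also have "\<dots> \<le> (\<integral>\<^sup>+u. ennreal B * (h u * indicator {0..1} u) \<partial>lborel)"
    using B by (intro nn_integral_mono) (auto simp: indicator_def intro!: mult_right_mono ennreal_leI)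
  also have "\<dots> = ennreal B * (\<integral>\<^sup>+u. h u * indicator {0..1} u \<partial>lborel)"
    by (intro nn_integral_cmult) measurable
  finally show ?thesis .
qed

text \<open>Independence recast as a product form of the joint law, so that expectations become
  iterated integrals.\<close>

lemma distr_iid_torus_array:
  assumes M: "prob_space M" and iid: "iid_torus_array M \<rho> N d \<omega>" and N: "N \<ge> 1" and d: "d \<ge> 1"
  defines "I \<equiv> {1..N} \<times> {1..d}"
  shows "prob_space (torus_measure \<rho>)"
    and "(\<lambda>x. \<lambda>i\<in>I. \<omega> (fst i) (snd i) x) \<in> measurable M (Pi\<^sub>M I (\<lambda>_. borel))"
    and "distr M (Pi\<^sub>M I (\<lambda>_. borel)) (\<lambda>x. \<lambda>i\<in>I. \<omega> (fst i) (snd i) x) = Pi\<^sub>M I (\<lambda>_. torus_measure \<rho>)"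
proof -
  interpret prob_space M by fact
  have dist: "distributed M lborel (\<omega> (fst i) (snd i)) (\<lambda>x. ennreal (\<rho> x * indicator {0..<1} x))"
    if "i \<in> I" for i
    using iid that by (auto simp: iid_torus_array_def I_def)
  have meas: "\<omega> (fst i) (snd i) \<in> measurable M borel" if "i \<in> I" for i
    using distributed_measurable[OF dist[OF that]] by simp
  have law: "distr M borel (\<omega> (fst i) (snd i)) = torus_measure \<rho>" if "i \<in> I" for i
  proof -
    have "distr M borel (\<omega> (fst i) (snd i)) = distr M lborel (\<omega> (fst i) (snd i))"
      by (rule distr_cong) auto
    then show ?thesis
      using distributed_distr_eq_density[OF dist[OF that]] by (simp add: torus_measure_def)
  qed
  \<comment> \<open>The characterisation of independence by the product law is applied to a nonempty
    index set.\<close>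
  have ne: "I \<noteq> {}" using N d by (auto simp: I_def)
  then obtain i where i: "i \<in> I" by auto
  show "prob_space (torus_measure \<rho>)"
    using prob_space_distr[OF meas[OF i]] law[OF i] by simp
  show "(\<lambda>x. \<lambda>i\<in>I. \<omega> (fst i) (snd i) x) \<in> measurable M (Pi\<^sub>M I (\<lambda>_. borel))"
    using meas by (intro measurable_restrict) auto
  have "indep_vars (\<lambda>_. borel) (\<lambda>i. \<omega> (fst i) (snd i)) I"
    using iid by (simp add: iid_torus_array_def I_def case_prod_unfold)
  then have "distr M (Pi\<^sub>M I (\<lambda>_. borel)) (\<lambda>x. \<lambda>i\<in>I. \<omega> (fst i) (snd i) x) =
      Pi\<^sub>M I (\<lambda>i. distr M borel (\<omega> (fst i) (snd i)))"
    using meas by (subst (asm) indep_vars_iff_distr_eq_PiM'[OF ne]) auto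
  also have "\<dots> = Pi\<^sub>M I (\<lambda>_. torus_measure \<rho>)"
    using law by (intro PiM_cong) auto
  finally show "distr M (Pi\<^sub>M I (\<lambda>_. borel)) (\<lambda>x. \<lambda>i\<in>I. \<omega> (fst i) (snd i) x) = Pi\<^sub>M I (\<lambda>_. torus_measure \<rho>)" .
qed

text \<open>On the product space the coordinates \<open>(j + 1, 1)\<close> and
  \<open>(j + 1, 2)\<close> are integrated with all others frozen; the bound so obtained is constant
  and survives integration over the rest.\<close>

lemma row_dev_second_moment:
  assumes M: "prob_space M" and iid: "iid_torus_array M \<rho> N d \<omega>"
    and dens: "\<rho> \<in> borel_measurable borel" "B \<ge> 0" "\<And>x. x \<in> {0..1} \<Longrightarrow> \<rho> x \<le> B"
    and d: "2 \<le> d" and j: "j < N" and z: "Im z > 0"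
  shows "(\<lambda>x. row_dev (X_mat N d (\<lambda>j q. \<omega> j q x)) z j) \<in> borel_measurable M"
    and "(\<integral>\<^sup>+x. ennreal ((cmod (row_dev (X_mat N d (\<lambda>j q. \<omega> j q x)) z j))\<^sup>2) \<partial>M)
      \<le> ennreal (B\<^sup>2 / (real N * (Im z)\<^sup>2))"
proof -
  interpret prob_space M by fact
  define I where "I = {1..N} \<times> {1..d}"
  define T where "T x = (\<lambda>i\<in>I. \<omega> (fst i) (snd i) x)" for x
  define \<Phi> where "\<Phi> y = row_dev (X_mat N d (\<lambda>j q. y (j, q))) z j" for y :: "nat \<times> nat \<Rightarrow> real"
  define \<mu> where "\<mu> = torus_measure \<rho>"
  have N: "N \<ge> 1" and d1: "d \<ge> 1" using j d by auto
  note law = distr_iid_torus_array[OF M iid N d1, folded I_def]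
  have T [measurable]: "T \<in> measurable M (Pi\<^sub>M I (\<lambda>_. borel))"
    using law(2) by (simp add: T_def[abs_def])
  have \<Phi>T: "row_dev (X_mat N d (\<lambda>j q. \<omega> j q x)) z j = \<Phi> (T x)" for x
    unfolding \<Phi>_def by (intro arg_cong[where f = "\<lambda>X. row_dev X z j"] X_mat_cong) (auto simp: T_def I_def)
  have \<Phi> [measurable]: "\<Phi> \<in> borel_measurable (Pi\<^sub>M I (\<lambda>_. borel))"
    unfolding \<Phi>_def
    by (intro borel_measurable_row_dev[OF X_mat_carrier j] borel_measurable_X_mat measurable_component_singleton)
       (auto simp: I_def)
  show "(\<lambda>x. row_dev (X_mat N d (\<lambda>j q. \<omega> j q x)) z j) \<in> borel_measurable M"
    unfolding \<Phi>T by measurable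
  have sets: "sets (Pi\<^sub>M I' (\<lambda>_. \<mu>)) = sets (Pi\<^sub>M I' (\<lambda>_. borel :: real measure))" for I' :: "(nat \<times> nat) set"
    by (intro sets_PiM_cong) (auto simp: \<mu>_def)
  interpret \<mu>: prob_space \<mu> using law(1) by (simp add: \<mu>_def)
  interpret P: product_sigma_finite "\<lambda>_ :: nat \<times> nat. \<mu>"
    by standard
  define J where "J = I - {(j + 1, 1), (j + 1, 2)}"
  define i\<^sub>1 i\<^sub>2 where "i\<^sub>1 = (j + 1, 1 :: nat)" and "i\<^sub>2 = (j + 1, 2 :: nat)"
  have I: "I = insert i\<^sub>1 (insert i\<^sub>2 J)"
    using j d by (auto simp: I_def J_def i\<^sub>1_def i\<^sub>2_def)
  have notin: "i\<^sub>1 \<notin> insert i\<^sub>2 J" "i\<^sub>2 \<notin> J" by (auto simp: J_def i\<^sub>1_def i\<^sub>2_def)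
  have fin: "finite J" "finite (insert i\<^sub>2 J)" by (auto simp: J_def I_def)
  define g where "g y = ennreal ((cmod (\<Phi> y))\<^sup>2)" for y
  have g0: "g \<in> borel_measurable (Pi\<^sub>M I (\<lambda>_. borel))" unfolding g_def by measurable
  then have g: "g \<in> borel_measurable (Pi\<^sub>M I (\<lambda>_. \<mu>))"
    by (simp add: measurable_cong_sets[OF sets refl])
  have "(\<integral>\<^sup>+x. g (T x) \<partial>M) = (\<integral>\<^sup>+y. g y \<partial>(distr M (Pi\<^sub>M I (\<lambda>_. borel)) T))"
    by (rule nn_integral_distr[symmetric]) (use T g0 in auto)
  also have "distr M (Pi\<^sub>M I (\<lambda>_. borel)) T = Pi\<^sub>M I (\<lambda>_. \<mu>)"
    using law(3) by (simp add: T_def[abs_def] \<mu>_def)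
  also have "(\<integral>\<^sup>+y. g y \<partial>Pi\<^sub>M I (\<lambda>_. \<mu>)) = (\<integral>\<^sup>+y. (\<integral>\<^sup>+u. g (y(i\<^sub>1 := u)) \<partial>\<mu>) \<partial>Pi\<^sub>M (insert i\<^sub>2 J) (\<lambda>_. \<mu>))"
    using g unfolding I by (intro P.product_nn_integral_insert fin notin)
  also have "\<dots> = (\<integral>\<^sup>+y. (\<integral>\<^sup>+v. (\<integral>\<^sup>+u. g (y(i\<^sub>2 := v, i\<^sub>1 := u)) \<partial>\<mu>) \<partial>\<mu>) \<partial>Pi\<^sub>M J (\<lambda>_. \<mu>))"
  proof (intro P.product_nn_integral_insert fin notin)
    have g': "g \<in> borel_measurable (Pi\<^sub>M (insert i\<^sub>1 (insert i\<^sub>2 J)) (\<lambda>_. \<mu>))" using g by (simp add: I)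
    have "(\<lambda>(y, u). g (y(i\<^sub>1 := u))) \<in> borel_measurable (Pi\<^sub>M (insert i\<^sub>2 J) (\<lambda>_. \<mu>) \<Otimes>\<^sub>M \<mu>)"
      using measurable_compose[OF measurable_add_dim g'] by (simp add: case_prod_unfold)
    then show "(\<lambda>y. \<integral>\<^sup>+u. g (y(i\<^sub>1 := u)) \<partial>\<mu>) \<in> borel_measurable (Pi\<^sub>M (insert i\<^sub>2 J) (\<lambda>_. \<mu>))"
      by (rule \<mu>.borel_measurable_nn_integral)
  qed
  also have "\<dots> \<le> (\<integral>\<^sup>+y. ennreal (B\<^sup>2 / (real N * (Im z)\<^sup>2)) \<partial>Pi\<^sub>M J (\<lambda>_. \<mu>))"
  proof (intro nn_integral_mono)
    fix y :: "nat \<times> nat \<Rightarrow> real"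
    define w where "w j q = y (j, q)" for j q
    \<comment> \<open>Overwriting the two coordinates in the product space is the row update for
      which the conditional bound was proved.\<close>
    have "(\<lambda>j' q. (y(i\<^sub>2 := v, i\<^sub>1 := u)) (j', q)) = w(j + 1 := (w (j + 1))(1 := u, 2 := v))" for u v
      by (auto simp: fun_eq_iff w_def i\<^sub>1_def i\<^sub>2_def)
    then have "g (y(i\<^sub>2 := v, i\<^sub>1 := u)) =
      ennreal ((cmod (row_dev (X_mat N d (w(j + 1 := (w (j + 1))(1 := u, 2 := v)))) z j))\<^sup>2)" for u v
      by (simp add: g_def \<Phi>_def)
    then show "(\<integral>\<^sup>+v. (\<integral>\<^sup>+u. g (y(i\<^sub>2 := v, i\<^sub>1 := u)) \<partial>\<mu>) \<partial>\<mu>) \<le> ennreal (B\<^sup>2 / (real N * (Im z)\<^sup>2))"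
      using nn_integral_row_dev[OF j d z _ dens(2), of \<mu> w] nn_integral_torus_measure_le[OF dens(1) _ dens(3)]
      by (simp add: \<mu>_def)
  qed
  also have "\<dots> = ennreal (B\<^sup>2 / (real N * (Im z)\<^sup>2))"
  proof -
    interpret PJ: prob_space "Pi\<^sub>M J (\<lambda>_. \<mu>)"
      by (intro prob_space_PiM) (rule \<mu>.prob_space_axioms)
    show ?thesis by (simp add: PJ.emeasure_space_1)
  qed
  finally show "(\<integral>\<^sup>+x. ennreal ((cmod (row_dev (X_mat N d (\<lambda>j q. \<omega> j q x)) z j))\<^sup>2) \<partial>M)
      \<le> ennreal (B\<^sup>2 / (real N * (Im z)\<^sup>2))"
    by (simp add: \<Phi>T g_def)
qed

subsection \<open>The local law\<close>

text \<open>Averaging over the rows leaves one random variable per spectral parameter, so that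
  Markov's inequality is applied once per grid point.\<close>

definition mean_sq_dev :: "nat \<Rightarrow> nat \<Rightarrow> (nat \<Rightarrow> nat \<Rightarrow> real) \<Rightarrow> complex \<Rightarrow> real" where
  "mean_sq_dev N d w z = (\<Sum>j<N. (cmod (row_dev (X_mat N d w) z j))\<^sup>2) / real N"

text \<open>Cauchy-Schwarz replaces the mean of the deviations by the root of their mean
  square.\<close>

lemma m_emp_near_m_MP:
  assumes N: "N > 0" and z: "Im z > 0" and c: "0 < c" "c \<le> Im (m_MP z)"
  shows "cmod (m_emp N d w z - m_MP z) \<le>
    (sqrt (mean_sq_dev N d w z) + 1 / (real N * (Im z)\<^sup>2)) / (c * Im z)"
proof -
  let ?Q = "\<lambda>j. cmod (row_dev (X_mat N d w) z j)"
  have "(\<Sum>j<N. ?Q j) / real N \<le> sqrt (mean_sq_dev N d w z)"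
  proof (rule real_le_rsqrt)
    have "(\<Sum>j<N. ?Q j)\<^sup>2 \<le> real N * (\<Sum>j<N. (?Q j)\<^sup>2)"
      using sum_squared_le_sum_of_squares[of ?Q "{..<N}"] by (simp add: mult.commute)
    then show "((\<Sum>j<N. ?Q j) / real N)\<^sup>2 \<le> mean_sq_dev N d w z"
      using N by (simp add: mean_sq_dev_def power2_eq_square field_simps)
  qed
  moreover have "cmod (m_emp N d w z - m_MP z) \<le>
      ((\<Sum>j<N. ?Q j) / real N + 1 / (real N * (Im z)\<^sup>2)) / (c * Im z)"
    unfolding m_emp_eq_resolvent[OF z]
    by (rule resolvent_trace_near_root[OF X_mat_carrier z N cnorm_crow_X_mat m_MP_quadratic[OF z] c])
  ultimately show ?thesis
    using c z by (smt (verit) divide_right_mono mult_nonneg_nonneg)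
qed

text \<open>The second moment bound is the same for every row, hence also holds for the average;
  then Markov's inequality.\<close>

lemma prob_mean_sq_dev:
  assumes M: "prob_space M" and iid: "iid_torus_array M \<rho> N d \<omega>"
    and dens: "\<rho> \<in> borel_measurable borel" "B \<ge> 0" "\<And>x. x \<in> {0..1} \<Longrightarrow> \<rho> x \<le> B"
    and d: "2 \<le> d" and N: "N > 0" and z: "Im z > 0" and t: "t > 0"
  defines "A \<equiv> {x \<in> space M. t \<le> mean_sq_dev N d (\<lambda>j q. \<omega> j q x) z}"
  shows "A \<in> sets M" and "measure M A \<le> B\<^sup>2 / (real N * (Im z)\<^sup>2 * t)"
proof -
  interpret prob_space M by fact
  let ?V = "\<lambda>x. mean_sq_dev N d (\<lambda>j q. \<omega> j q x) z"
  let ?q = "\<lambda>j x. (cmod (row_dev (X_mat N d (\<lambda>j q. \<omega> j q x)) z j))\<^sup>2"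
  let ?b = "B\<^sup>2 / (real N * (Im z)\<^sup>2)"
  have mq: "?q j \<in> borel_measurable M" if "j < N" for j
    using row_dev_second_moment(1)[OF M iid dens d that z] by measurable
  have V [measurable]: "?V \<in> borel_measurable M"
    unfolding mean_sq_dev_def using mq by (intro borel_measurable_divide borel_measurable_sum) auto
  show A: "A \<in> sets M" unfolding A_def by measurable
  have "(\<integral>\<^sup>+x. ennreal (?V x) \<partial>M) = (\<integral>\<^sup>+x. ennreal (1 / real N) * (\<Sum>j<N. ennreal (?q j x)) \<partial>M)"
    unfolding mean_sq_dev_def
    by (intro nn_integral_cong) (simp add: sum_ennreal ennreal_mult'[symmetric] sum_nonneg)
  also have "\<dots> = ennreal (1 / real N) * (\<integral>\<^sup>+x. (\<Sum>j<N. ennreal (?q j x)) \<partial>M)"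
    using mq by (intro nn_integral_cmult borel_measurable_sum) auto
  also have "\<dots> = ennreal (1 / real N) * (\<Sum>j<N. \<integral>\<^sup>+x. ennreal (?q j x) \<partial>M)"
    using mq by (subst nn_integral_sum) auto
  also have "\<dots> \<le> ennreal (1 / real N) * (\<Sum>j<N. ennreal ?b)"
    by (intro mult_left_mono sum_mono row_dev_second_moment(2)[OF M iid dens d _ z]) auto
  also have "\<dots> = ennreal (1 / real N * (real N * ?b))"
    by (simp only: sum_constant card_lessThan ennreal_of_nat_eq_real_of_nat) (simp only: ennreal_mult' of_nat_0_le_iff zero_le_divide_1_iff)
  also have "1 / real N * (real N * ?b) = ?b" using N by simp
  finally have EV: "(\<integral>\<^sup>+x. ennreal (?V x) \<partial>M) \<le> ennreal ?b" .
  have "emeasure M {x \<in> space M. 1 \<le> ennreal (1 / t) * ennreal (?V x)} \<le>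
      ennreal (1 / t) * (\<integral>\<^sup>+x. ennreal (?V x) * indicator (space M) x \<partial>M)"
    by (intro nn_integral_Markov_inequality) auto
  also have "(\<integral>\<^sup>+x. ennreal (?V x) * indicator (space M) x \<partial>M) = (\<integral>\<^sup>+x. ennreal (?V x) \<partial>M)"
    by (intro nn_integral_cong) auto
  also have "ennreal (1 / t) * \<dots> \<le> ennreal (1 / t) * ennreal ?b"
    by (intro mult_left_mono EV) auto
  also have "{x \<in> space M. 1 \<le> ennreal (1 / t) * ennreal (?V x)} = A"
  proof -
    have "1 \<le> ennreal (1 / t) * ennreal y \<longleftrightarrow> t \<le> y" for y
      using t by (simp add: ennreal_mult'[symmetric] ennreal_ge_1 pos_le_divide_eq)
    then show ?thesis by (simp add: A_def)
  qed
  also have "ennreal (1 / t) * ennreal ?b = ennreal (B\<^sup>2 / (real N * (Im z)\<^sup>2 * t))"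
    using t by (simp add: ennreal_mult'[symmetric] mult_ac)
  finally show "measure M A \<le> B\<^sup>2 / (real N * (Im z)\<^sup>2 * t)"
    using t by (simp add: emeasure_eq_measure)
qed

text \<open>Rounding up keeps the imaginary part from decreasing.\<close>

definition grid_ceiling :: "nat \<Rightarrow> complex \<Rightarrow> complex" where
  "grid_ceiling K z = Complex (real (nat \<lceil>real K * Re z\<rceil>) / real K) (real (nat \<lceil>real K * Im z\<rceil>) / real K)"

lemma ceiling_grid:
  assumes "0 \<le> x" "K > 0"
  shows "x \<le> real (nat \<lceil>real K * x\<rceil>) / real K" "real (nat \<lceil>real K * x\<rceil>) / real K \<le> x + 1 / real K"
proof -
  have "0 \<le> real K * x" using assms by simp
  then have eq: "real (nat \<lceil>real K * x\<rceil>) = of_int \<lceil>real K * x\<rceil>" by simp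
  have "real K * x \<le> of_int \<lceil>real K * x\<rceil>" "of_int \<lceil>real K * x\<rceil> \<le> real K * x + 1"
    by linarith+
  then show "x \<le> real (nat \<lceil>real K * x\<rceil>) / real K" "real (nat \<lceil>real K * x\<rceil>) / real K \<le> x + 1 / real K"
    unfolding eq using assms by (simp_all add: field_simps)
qed

lemma grid_ceiling_bounds:
  assumes "0 \<le> Re z" "0 \<le> Im z" "K > 0"
  shows "Re z \<le> Re (grid_ceiling K z)" "Re (grid_ceiling K z) \<le> Re z + 1 / real K"
    "Im z \<le> Im (grid_ceiling K z)" "Im (grid_ceiling K z) \<le> Im z + 1 / real K"
    "cmod (z - grid_ceiling K z) \<le> 2 / real K"
proof -
  show b: "Re z \<le> Re (grid_ceiling K z)" "Re (grid_ceiling K z) \<le> Re z + 1 / real K"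
    "Im z \<le> Im (grid_ceiling K z)" "Im (grid_ceiling K z) \<le> Im z + 1 / real K"
    using ceiling_grid[OF assms(1,3)] ceiling_grid[OF assms(2,3)] by (simp_all add: grid_ceiling_def)
  have "cmod (z - grid_ceiling K z) \<le> \<bar>Re (z - grid_ceiling K z)\<bar> + \<bar>Im (z - grid_ceiling K z)\<bar>"
    by (rule cmod_le)
  also have "\<dots> \<le> 1 / real K + 1 / real K" using b by (intro add_mono) auto
  finally show "cmod (z - grid_ceiling K z) \<le> 2 / real K" by simp
qed

definition grid :: "nat \<Rightarrow> complex set" where
  "grid K = (\<lambda>(a, b). Complex (real a / real K) (real b / real K)) ` ({0..4 * K} \<times> {0..K})"

lemma finite_grid: "finite (grid K)"
  by (simp add: grid_def)

lemma card_grid: "K > 0 \<Longrightarrow> card (grid K) \<le> 10 * K\<^sup>2"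
proof -
  assume K: "K > 0"
  have "card (grid K) \<le> card ({0..4 * K} \<times> {0..K})"
    unfolding grid_def by (rule card_image_le) auto
  also have "\<dots> = (4 * K + 1) * (K + 1)" by (simp add: card_cartesian_product)
  also have "\<dots> \<le> (5 * K) * (2 * K)" using K by (intro mult_mono) auto
  also have "\<dots> = 10 * K\<^sup>2" by (simp add: power2_eq_square)
  finally show ?thesis .
qed

lemma grid_ceiling_in_grid:
  assumes "0 \<le> Re z" "Re z \<le> 4" "0 \<le> Im z" "Im z \<le> 1" "K > 0"
  shows "grid_ceiling K z \<in> grid K"
proof -
  have "real K * Re z \<le> of_int (int (4 * K))" using assms mult_left_mono[of "Re z" 4 "real K"] by simp
  then have "nat \<lceil>real K * Re z\<rceil> \<le> 4 * K" by linarith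
  moreover have "real K * Im z \<le> of_int (int K)" using assms mult_left_mono[of "Im z" 1 "real K"] by simp
  then have "nat \<lceil>real K * Im z\<rceil> \<le> K" by linarith
  ultimately show ?thesis unfolding grid_def grid_ceiling_def by (intro image_eqI[of _ _ "(_, _)"]) auto
qed

section \<open>The exponent 1/36 and the union bound\<close>

text \<open>Here \<open>(2 p + 4) / 36 = p / 18 + 1 / 9\<close>, which exceeds
  \<open>p / 18 - 1\<close>. One scale, the power 1/36 of \<open>N\<close>, can thus stand in for
  both exponents of the theorem.\<close>

lemma theta0_less: "theta0 d < 1 / 36"
proof -
  define p where "p = real_of_int \<lfloor>17 * real d / 16\<rfloor>"
  have "0 \<le> \<lfloor>17 * real d / 16\<rfloor>" by simp
  then have p: "p \<ge> 0" by (simp add: p_def)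
  then have "(p / 18 - 1) / (2 * p + 4) < 1 / 36"
    by (simp add: pos_divide_less_eq)
  then show ?thesis by (simp add: theta0_def p_def Let_def)
qed

text \<open>The estimate at a single \<open>N\<close>, with every loss a power of \<open>s\<close>
  against \<open>N = s ^ 36\<close>. The bad set is a union over uncountably many \<open>z\<close>;
  it is enclosed in a finite union of measurable events, one for each relevant grid point.\<close>

lemma local_law_prob:
  assumes dens: "\<rho> \<in> borel_measurable borel" "B \<ge> 0" "\<And>x. x \<in> {0..1} \<Longrightarrow> \<rho> x \<le> B"
    and M: "prob_space M" and iid: "iid_torus_array M \<rho> N d \<omega>" and N: "N \<ge> 1" and d: "d \<ge> 2"
    and \<kappa>: "0 < \<kappa>" "\<kappa> < 1"
  defines "s \<equiv> real N powr (1 / 36)" and "c\<^sub>0 \<equiv> sqrt (\<kappa> / 64)"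
  assumes s: "1 / \<kappa> \<le> s" "4 / c\<^sub>0 \<le> s"
  shows "\<exists>A\<in>sets M. {x \<in> space M. \<exists>z. \<kappa> < Re z \<and> Re z < 4 - \<kappa> \<and> 1 / s \<le> Im z \<and> Im z < \<kappa> / 8 \<and>
      1 / (s * Im z) < cmod (m_emp N d (\<lambda>j q. \<omega> j q x) z - m_MP z)} \<subseteq> A \<and>
    measure M A \<le> 12960 * B\<^sup>2 / c\<^sub>0\<^sup>2 / s" (is "\<exists>A\<in>sets M. ?Bad \<subseteq> A \<and> _")
proof -
  interpret prob_space M by fact
  \<comment> \<open>Rounding moves \<open>z\<close> by at most
    \<open>2 / K \<le> 1 / (4 s\<^sup>2)\<close>; with the Lipschitz factor \<open>s / Im z\<close>
    each transform changes by at most \<open>1 / (4 s Im z)\<close>.\<close>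
  define K where "K = nat \<lceil>8 * s\<^sup>2\<rceil>"
  \<comment> \<open>Chosen such that \<open>sqrt t = c\<^sub>0 / (4 s)\<close>; the rank-one error
    gets the same allowance.\<close>
  define t where "t = c\<^sub>0\<^sup>2 / (16 * s\<^sup>2)"
  \<comment> \<open>Rounding up adds at most \<kappa>/8 to each coordinate, whence the wider
    margins. They are those of \<open>m_MP_Im_lower\<close> at \<kappa>/2, whose lower bound is then
    exactly \<open>c\<^sub>0\<close>.\<close>
  define \<Gamma> where "\<Gamma> = {z \<in> grid K. \<kappa> / 2 \<le> Re z \<and> Re z \<le> 4 - \<kappa> / 2 \<and> 1 / s \<le> Im z \<and> Im z \<le> \<kappa> / 4}"
  define A where "A z = {x \<in> space M. t \<le> mean_sq_dev N d (\<lambda>j q. \<omega> j q x) z}" for z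
  have s1: "1 \<le> s" using \<kappa> s(1) by (smt (verit) le_divide_eq_1_pos)
  have c0: "c\<^sub>0 > 0" using \<kappa> by (simp add: c\<^sub>0_def)
  have t: "t > 0" using c0 s1 by (simp add: t_def)
  have Ns: "real N = s ^ 36"
    using N by (simp add: s_def powr_realpow[symmetric] powr_powr)
  have K8: "8 * s\<^sup>2 \<le> real K" unfolding K_def by linarith
  have s2: "1 \<le> s\<^sup>2" "s \<le> s\<^sup>2" using s1 one_le_power[of s 2] by (simp_all add: power2_eq_square)
  have K9: "real K \<le> 9 * s\<^sup>2" unfolding K_def using s2 by linarith
  have K0: "K > 0" using K8 s2 by (cases K) auto
  have \<kappa>K: "1 / real K \<le> \<kappa> / 8"
  proof -
    have "8 / \<kappa> \<le> real K" using K8 s2 s(1) by simp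
    then show ?thesis using \<kappa> K0 by (simp add: field_simps)
  qed
  have \<Gamma>z: "Im z > 0" if "z \<in> \<Gamma>" for z
  proof -
    have "0 < 1 / s" using s1 by simp
    also have "\<dots> \<le> Im z" using that by (simp add: \<Gamma>_def)
    finally show ?thesis .
  qed
  have good: "cmod (m_emp N d w z - m_MP z) \<le> 1 / (2 * s * Im z)"
    if z: "z \<in> \<Gamma>" and w: "mean_sq_dev N d w z < t" for z w
  proof -
    have im: "Im z > 0" by (rule \<Gamma>z[OF z])
    have c: "c\<^sub>0 \<le> Im (m_MP z)"
      using m_MP_Im_lower[of "\<kappa> / 2" z] z \<kappa> im by (simp add: \<Gamma>_def c\<^sub>0_def)
    have "sqrt (mean_sq_dev N d w z) \<le> sqrt t" using w by simp
    also have "sqrt t = c\<^sub>0 / (4 * s)"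
      using c0 s1 by (simp add: t_def real_sqrt_divide real_sqrt_mult)
    finally have 1: "sqrt (mean_sq_dev N d w z) \<le> c\<^sub>0 / (4 * s)" .
    \<comment> \<open>Since \<open>Im z \<ge> 1 / s\<close>, the denominator is at least
      \<open>s ^ 34\<close>, and one factor \<open>s\<close> already absorbs
      \<open>4 / c\<^sub>0\<close>.\<close>
    have 2: "1 / (real N * (Im z)\<^sup>2) \<le> c\<^sub>0 / (4 * s)"
    proof -
      have "1 / s \<le> Im z" using z by (simp add: \<Gamma>_def)
      then have "(1 / s)\<^sup>2 \<le> (Im z)\<^sup>2" using s1 by (intro power_mono) auto
      then have "s ^ 36 * (1 / s)\<^sup>2 \<le> real N * (Im z)\<^sup>2"
        unfolding Ns using s1 by (intro mult_left_mono) auto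
      moreover have "s ^ 36 * (1 / s)\<^sup>2 = s ^ 34"
      proof -
        have "s ^ 36 = s ^ 34 * s\<^sup>2" by (simp add: power_add[symmetric])
        moreover have "s\<^sup>2 * (1 / s)\<^sup>2 = 1" using s1 by (simp add: power_divide)
        ultimately show ?thesis by (metis mult.assoc mult.right_neutral)
      qed
      moreover have "s * (4 / c\<^sub>0) \<le> s ^ 34"
      proof -
        have "s * (4 / c\<^sub>0) \<le> s * s" using s(2) s1 by (intro mult_left_mono) auto
        also have "\<dots> = s ^ 2" by (simp add: power2_eq_square)
        also have "\<dots> \<le> s ^ 34" using s1 by (intro power_increasing) auto
        finally show ?thesis .
      qed
      ultimately have "s * (4 / c\<^sub>0) \<le> real N * (Im z)\<^sup>2" by linarith
      moreover have "0 < s * (4 / c\<^sub>0)" using s1 c0 by simp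
      ultimately have "1 / (real N * (Im z)\<^sup>2) \<le> 1 / (s * (4 / c\<^sub>0))"
        by (intro frac_le) auto
      then show ?thesis by (simp add: mult.commute)
    qed
    have "cmod (m_emp N d w z - m_MP z) \<le>
        (sqrt (mean_sq_dev N d w z) + 1 / (real N * (Im z)\<^sup>2)) / (c\<^sub>0 * Im z)"
      using N by (intro m_emp_near_m_MP im c0 c) auto
    also have "\<dots> \<le> (c\<^sub>0 / (4 * s) + c\<^sub>0 / (4 * s)) / (c\<^sub>0 * Im z)"
      using 1 2 c0 im by (intro divide_right_mono add_mono) auto
    also have "\<dots> = 1 / (2 * s * Im z)" using c0 im s1 by (simp add: field_simps)
    finally show ?thesis .
  qed
  have sub: "?Bad \<subseteq> (\<Union>z\<in>\<Gamma>. A z)"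
  proof
    fix x assume "x \<in> ?Bad"
    then obtain z where x: "x \<in> space M" and z: "\<kappa> < Re z" "Re z < 4 - \<kappa>" "1 / s \<le> Im z" "Im z < \<kappa> / 8"
      and bad: "1 / (s * Im z) < cmod (m_emp N d (\<lambda>j q. \<omega> j q x) z - m_MP z)"
      by blast
    define w where "w j q = \<omega> j q x" for j q
    define z' where "z' = grid_ceiling K z"
    have "0 < 1 / s" using s1 by simp
    then have im: "Im z > 0" using z(3) by linarith
    note gb = grid_ceiling_bounds[of z K, folded z'_def]
    have gb': "Re z \<le> Re z'" "Re z' \<le> Re z + 1 / real K" "Im z \<le> Im z'" "Im z' \<le> Im z + 1 / real K"
      "cmod (z - z') \<le> 2 / real K"
      using gb z \<kappa> im K0 by auto
    have z': "z' \<in> \<Gamma>"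
    proof -
      have "z' \<in> grid K" unfolding z'_def using z \<kappa> im K0 by (intro grid_ceiling_in_grid) auto
      then show ?thesis unfolding \<Gamma>_def using gb' z \<kappa> \<kappa>K by simp
    qed
    show "x \<in> (\<Union>z\<in>\<Gamma>. A z)"
    proof (rule ccontr)
      assume "x \<notin> (\<Union>z\<in>\<Gamma>. A z)"
      then have "mean_sq_dev N d w z' < t" using x z' by (auto simp: A_def w_def[abs_def])
      then have g: "cmod (m_emp N d w z' - m_MP z') \<le> 1 / (2 * s * Im z')" by (rule good[OF z'])
      \<comment> \<open>The grid point lies no lower than \<open>z\<close>, so its bound can be
        restated at the height of \<open>z\<close>.\<close>
      also have "\<dots> \<le> 1 / (2 * s * Im z)"
        using gb' im s1 by (intro divide_left_mono mult_left_mono) auto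
      finally have g: "cmod (m_emp N d w z' - m_MP z') \<le> 1 / (2 * s * Im z)" .
      have L: "cmod (z - z') / (Im z * Im z') \<le> 1 / (4 * s * Im z)"
      proof -
        have "cmod (z - z') \<le> 2 / (8 * s\<^sup>2)"
          using gb'(5) K8 s2 by (smt (verit) frac_le)
        moreover have "1 / (Im z * Im z') \<le> s / Im z"
        proof -
          have "1 / s \<le> Im z'" using gb' z by linarith
          then have "1 / Im z' \<le> s" using s1 im gb'(3) by (simp add: field_simps)
          then have "1 / Im z' / Im z \<le> s / Im z" using im by (intro divide_right_mono) auto
          then show ?thesis by (simp add: mult.commute)
        qed
        ultimately have "cmod (z - z') * (1 / (Im z * Im z')) \<le> 2 / (8 * s\<^sup>2) * (s / Im z)"
          using im gb'(3) s1 by (intro mult_mono) auto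
        also have "\<dots> = 1 / (4 * s * Im z)" using s1 im by (simp add: field_simps power2_eq_square)
        finally show ?thesis by simp
      qed
      have im': "Im z' > 0" using im gb' by linarith
      have "cmod (m_emp N d w z - m_emp N d w z') \<le> 1 / (4 * s * Im z)"
        using m_emp_Lipschitz[OF im im', of N d w] N L by simp
      moreover have "cmod (m_MP z - m_MP z') \<le> 1 / (4 * s * Im z)"
        using m_MP_Lipschitz[OF im im'] L by simp
      moreover have "m_emp N d w z - m_MP z =
        (m_emp N d w z - m_emp N d w z') + (m_emp N d w z' - m_MP z') + (m_MP z' - m_MP z)" by simp
      then have "cmod (m_emp N d w z - m_MP z) \<le> cmod (m_emp N d w z - m_emp N d w z') +
          cmod (m_emp N d w z' - m_MP z') + cmod (m_MP z' - m_MP z)"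
        by (metis (no_types) norm_triangle_le add_right_mono norm_triangle_ineq order_refl)
      \<comment> \<open>A quarter of the allowed error for the move of each transform, one half for
        the grid point.\<close>
      ultimately have "cmod (m_emp N d w z - m_MP z) \<le>
          1 / (4 * s * Im z) + 1 / (2 * s * Im z) + 1 / (4 * s * Im z)"
        using g norm_minus_commute[of "m_MP z" "m_MP z'"] by linarith
      also have "\<dots> = 1 / (s * Im z)" using s1 im by (simp add: field_simps)
      finally show False using bad by (simp add: w_def[abs_def])
    qed
  qed
  have A: "A z \<in> sets M" "measure M (A z) \<le> 16 * B\<^sup>2 / c\<^sub>0\<^sup>2 * s ^ 4 / s ^ 36" if z: "z \<in> \<Gamma>" for z
  proof -
    have im: "Im z > 0" by (rule \<Gamma>z[OF z])
    note P = prob_mean_sq_dev[OF M iid dens d _ im t, folded A_def]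
    show "A z \<in> sets M" using P(1) N by simp
    have "1 / s \<le> Im z" using z by (simp add: \<Gamma>_def)
    then have "(1 / s)\<^sup>2 \<le> (Im z)\<^sup>2" using s1 by (intro power_mono) auto
    \<comment> \<open>In Markov's bound the height and the threshold \<open>t\<close> cost a factor
      \<open>s\<^sup>2\<close> each.\<close>
    then have "B\<^sup>2 / (real N * (Im z)\<^sup>2 * t) \<le> B\<^sup>2 / (real N * (1 / s)\<^sup>2 * t)"
      using N s1 t by (intro divide_left_mono mult_right_mono mult_left_mono mult_pos_pos) (auto simp: im)
    also have "\<dots> = 16 * B\<^sup>2 / c\<^sub>0\<^sup>2 * s ^ 4 / s ^ 36"
    proof -
      have "(1 / s)\<^sup>2 * t = c\<^sub>0\<^sup>2 / (16 * (s\<^sup>2 * s\<^sup>2))" by (simp add: t_def power_divide)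
      also have "s\<^sup>2 * s\<^sup>2 = s ^ 4" by (simp add: power_add[symmetric])
      finally show ?thesis by (simp add: Ns mult.assoc) (simp add: mult_ac)
    qed
    finally show "measure M (A z) \<le> 16 * B\<^sup>2 / c\<^sub>0\<^sup>2 * s ^ 4 / s ^ 36" using P(2) N by simp
  qed
  have fin: "finite \<Gamma>" unfolding \<Gamma>_def using finite_grid by simp
  have meas: "(\<Union>z\<in>\<Gamma>. A z) \<in> sets M"
    using A(1) fin by (intro sets.finite_UN) auto
  have "measure M (\<Union>z\<in>\<Gamma>. A z) \<le> (\<Sum>z\<in>\<Gamma>. measure M (A z))"
    using A(1) fin by (intro finite_measure_subadditive_finite) auto
  also have "\<dots> \<le> (\<Sum>z\<in>\<Gamma>. 16 * B\<^sup>2 / c\<^sub>0\<^sup>2 * s ^ 4 / s ^ 36)"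
    by (intro sum_mono A(2))
  also have "\<dots> = real (card \<Gamma>) * (16 * B\<^sup>2 / c\<^sub>0\<^sup>2 * s ^ 4 / s ^ 36)" by simp
  \<comment> \<open>There are at most \<open>10 K\<^sup>2\<close> grid points with
    \<open>K \<le> 9 s\<^sup>2\<close>; then \<open>810 * 16 = 12960\<close>.\<close>
  also have "\<dots> \<le> (810 * s ^ 4) * (16 * B\<^sup>2 / c\<^sub>0\<^sup>2 * s ^ 4 / s ^ 36)"
  proof (rule mult_right_mono)
    have "card \<Gamma> \<le> card (grid K)" unfolding \<Gamma>_def by (intro card_mono finite_grid) auto
    also have "\<dots> \<le> 10 * K\<^sup>2" by (rule card_grid[OF K0])
    finally have "real (card \<Gamma>) \<le> 10 * (real K)\<^sup>2" by (metis of_nat_le_iff of_nat_mult of_nat_numeral of_nat_power)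
    also have "\<dots> \<le> 10 * (9 * s\<^sup>2)\<^sup>2" using K9 by (intro mult_left_mono power_mono) auto
    also have "\<dots> = 810 * s ^ 4" by (simp add: power_mult_distrib)
    finally show "real (card \<Gamma>) \<le> 810 * s ^ 4" .
  qed (use s1 in simp)
  also have "\<dots> = 12960 * B\<^sup>2 / c\<^sub>0\<^sup>2 * (s ^ 8 / s ^ 36)" by (simp add: power_add[symmetric])
  \<comment> \<open>Of the available decay only \<open>1 / s\<close> is kept, which is enough for
    convergence to 0.\<close>
  also have "\<dots> \<le> 12960 * B\<^sup>2 / c\<^sub>0\<^sup>2 * (1 / s)"
  proof (intro mult_left_mono)
    have "s ^ 8 * s \<le> s ^ 36" using s1 power_increasing[of 9 36 s] by (simp add: power_Suc2[symmetric])
    then show "s ^ 8 / s ^ 36 \<le> 1 / s" using s1 by (simp add: pos_divide_le_eq pos_le_divide_eq)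
  qed simp
  finally show ?thesis using sub meas by (intro bexI[of _ "\<Union>z\<in>\<Gamma>. A z"]) auto
qed

theorem theorem2p5:
  fixes \<rho> :: "real \<Rightarrow> real" and C :: real
    and M :: "nat \<Rightarrow> 'a measure"
    and \<omega> :: "nat \<Rightarrow> nat \<Rightarrow> nat \<Rightarrow> 'a \<Rightarrow> real"
    and d :: nat and \<theta> :: real
  assumes density: "torus_density C \<rho>"
    and prob: "\<And>N. N \<ge> 1 \<Longrightarrow> prob_space (M N)"
    and iid: "\<And>N. N \<ge> 1 \<Longrightarrow> iid_torus_array (M N) \<rho> N d (\<omega> N)"
    and d: "d \<ge> 18"
    and \<theta>: "0 < \<theta>" "\<theta> < theta0 d"
  shows "\<forall>\<kappa>\<in>{0<..<1}. \<exists>c>0.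
    (\<lambda>N. measure (M N) {x \<in> space (M N). \<exists>z\<in>spectral_domain \<kappa> \<theta> c N.
        \<not> cmod (m_emp N d (\<lambda>j q. \<omega> N j q x) z - m_MP z) \<le> real N powr (- theta0 d) / Im z})
      \<longlonglongrightarrow> 0"
proof
  fix \<kappa> :: real assume "\<kappa> \<in> {0<..<1}"
  then have \<kappa>: "0 < \<kappa>" "\<kappa> < 1" by auto
  obtain B where B: "B \<ge> 0" "\<And>x. x \<in> {0..1} \<Longrightarrow> \<rho> x \<le> B"
    using torus_density_bound[OF density] by blast
  note dens = torus_density_measurable[OF density] B
  define s where "s N = real N powr (1 / 36)" for N
  define c\<^sub>0 where "c\<^sub>0 = sqrt (\<kappa> / 64)"
  \<comment> \<open>The witness for \<open>c\<close> is \<kappa>/8, the height up to which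
    \<open>local_law_prob\<close> applies. \<open>E\<close> is the event of the claim,
    \<open>F\<close> its counterpart with both exponents replaced by 1/36.\<close>
  define E where "E N = {x \<in> space (M N). \<exists>z\<in>spectral_domain \<kappa> \<theta> (\<kappa> / 8) N.
        \<not> cmod (m_emp N d (\<lambda>j q. \<omega> N j q x) z - m_MP z) \<le> real N powr (- theta0 d) / Im z}" for N
  define F where "F N = {x \<in> space (M N). \<exists>z. \<kappa> < Re z \<and> Re z < 4 - \<kappa> \<and> 1 / s N \<le> Im z \<and> Im z < \<kappa> / 8 \<and>
      1 / (s N * Im z) < cmod (m_emp N d (\<lambda>j q. \<omega> N j q x) z - m_MP z)}" for N
  have lim: "filterlim s at_top sequentially"
    unfolding s_def by (rule filterlim_compose[OF real_powr_at_top filterlim_real_sequentially]) simp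
  \<comment> \<open>As \<open>s\<close> tends to infinity, the two size conditions of
    \<open>local_law_prob\<close> hold eventually.\<close>
  have "\<forall>\<^sub>F N in sequentially. norm (measure (M N) (E N)) \<le> 12960 * B\<^sup>2 / c\<^sub>0\<^sup>2 / s N"
    using eventually_ge_at_top[of 1] filterlim_at_top[THEN iffD1, OF lim, rule_format, of "1 / \<kappa>"]
      filterlim_at_top[THEN iffD1, OF lim, rule_format, of "4 / c\<^sub>0"]
  proof eventually_elim
    case (elim N)
    interpret prob_space "M N" by (rule prob) (use elim in simp)
    have EF: "E N \<subseteq> F N"
    proof
      fix x assume "x \<in> E N"
      then obtain z where x: "x \<in> space (M N)" and z: "z \<in> spectral_domain \<kappa> \<theta> (\<kappa> / 8) N"
        and bad: "\<not> cmod (m_emp N d (\<lambda>j q. \<omega> N j q x) z - m_MP z) \<le> real N powr (- theta0 d) / Im z"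
        by (auto simp: E_def)
      \<comment> \<open>Both \<theta> and \<open>theta0 d\<close> lie below 1/36, so passing to
        \<open>1 / s N\<close> enlarges the domain and lowers the threshold for failure; hence
        \<open>E\<close> is contained in \<open>F\<close>.\<close>
      have inv: "1 / s N = real N powr (- (1 / 36))" by (simp add: s_def powr_minus_divide)
      have "1 / s N \<le> real N powr (- \<theta>)"
        unfolding inv using elim \<theta> theta0_less[of d] by (intro powr_mono) auto
      then have im: "1 / s N \<le> Im z" using z by (auto simp: spectral_domain_def)
      have "0 < 1 / s N" using elim by (simp add: s_def)
      then have im0: "0 < Im z" using im by linarith
      have "1 / s N \<le> real N powr (- theta0 d)"
        unfolding inv using elim theta0_less[of d] by (intro powr_mono) auto
      then have "1 / s N / Im z \<le> real N powr (- theta0 d) / Im z"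
        using im0 by (intro divide_right_mono) auto
      then have "1 / (s N * Im z) < cmod (m_emp N d (\<lambda>j q. \<omega> N j q x) z - m_MP z)"
        using bad by simp
      then show "x \<in> F N" using x z im by (auto simp: F_def spectral_domain_def)
    qed
    obtain A where A: "A \<in> sets (M N)" "F N \<subseteq> A" "measure (M N) A \<le> 12960 * B\<^sup>2 / c\<^sub>0\<^sup>2 / s N"
      using local_law_prob[OF dens prob iid, of N \<kappa>] elim d \<kappa> unfolding F_def s_def c\<^sub>0_def by auto
    have "measure (M N) (E N) \<le> measure (M N) A"
      using A EF by (intro finite_measure_mono) auto
    then show ?case using A(3) by simp
  qed
  moreover have "(\<lambda>N. 12960 * B\<^sup>2 / c\<^sub>0\<^sup>2 / s N) \<longlonglongrightarrow> 0"
    by (intro tendsto_divide_0[OF tendsto_const] filterlim_at_top_imp_at_infinity lim)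
  ultimately have "(\<lambda>N. measure (M N) (E N)) \<longlonglongrightarrow> 0"
    by (rule Lim_null_comparison)
  then show "\<exists>c>0. (\<lambda>N. measure (M N) {x \<in> space (M N). \<exists>z\<in>spectral_domain \<kappa> \<theta> c N.
        \<not> cmod (m_emp N d (\<lambda>j q. \<omega> N j q x) z - m_MP z) \<le> real N powr (- theta0 d) / Im z})
      \<longlonglongrightarrow> 0"
    using \<kappa> unfolding E_def by (intro exI[of _ "\<kappa> / 8"]) auto
qed

end
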